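(* Let $1-\eta$ be the second largest eigenvalue of $M_1=\mathrm{diag}(1\oslash\mu_1)\,\gamma^*\,\mathrm{diag}(1\oslash\mu_2)\,(\gamma^* )^{T}$. For $\theta\in(0,2)$, let the overrelaxed projection algorithm with parameter $\theta$ be the iteration $\gamma^{\ell+1}=P^\theta_{\mathcal{C}_2}(P^\theta_{\mathcal{C}_1}(\gamma^\ell))$; the Sinkhorn–Knopp (SK) algorithm is the case $\theta=1$. Let $\theta^*=2/(1+\sqrt{\eta})$ and $$f(\theta,\eta)=\begin{cases}\theta-1 & \text{if }\theta>\theta^*,\\[2pt] \tfrac12\theta^2(1-\eta)-(\theta-1)+\tfrac12\sqrt{(1-\eta)\theta^2\big(\theta^2(1-\eta)-4(\theta-1)\big)} & \text{otherwise.}\end{cases}$$ Then: (i) the SK algorithm converges locally at the linear rate $1-\eta$; (ii) for the choice $\theta=\theta^*$, which is optimal in that it minimizes $\theta\mapsto f(\theta,\eta)$ over $(0,2)$, the overrelaxed projection algorithm converges locally at the linear rate $(1-\sqrt{\eta})/(1+\sqrt{\eta})$; (iii) for every $\theta\in(0,2)$, the overrelaxed projection algorithm with parameter $\theta$ converges locally, with linear rate $f(\theta,\eta)$.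
   Context: Let $\mathbb{R}_+=[0,\infty)$ and $\mathbb{R}_{+*}=(0,\infty)$. Let $n_1\ge 2$, $n_2\ge 1$ be integers, let $\mu_1\in\mathbb{R}_{+*}^{n_1}$ and $\mu_2\in\mathbb{R}_{+*}^{n_2}$ be discrete probability measures (positive entries summing to $1$), let $c\in\mathbb{R}_+^{n_1\times n_2}$ be a cost matrix, and let $\varepsilon>0$. Elements of $\mathbb{R}^{n_1n_2}$ are viewed as $n_1\times n_2$ matrices. Define the linear maps $(A_1x)_i=\sum_j x_{i,j}$ and $(A_2x)_j=\sum_i x_{i,j}$, and $\mathcal{C}_k=\{\gamma\in\mathbb{R}^{n_1n_2}: A_k\gamma=\mu_k\}$ for $k=1,2$. The symbol $\oslash$ denotes coordinatewise division, so $1\oslash\mu_k$ is the vector of inverses of the coordinates of $\mu_k$. Kullback–Leibler divergence: $\mathrm{KL}(\gamma,\zeta)=\sum_{i,j}\gamma_{i,j}\big(\log(\gamma_{i,j}/\zeta_{i,j})-1\big)+\sum_{i,j}\zeta_{i,j}$, with $0\log 0=0$. The matrix $\gamma^*$ is the unique minimizer of $\gamma\mapsto\sum_{i,j}c_{i,j}\gamma_{i,j}+\varepsilon\,\mathrm{KL}(\gamma,\mathbf{1})$ over $\mathcal{C}_1\cap\mathcal{C}_2\cap\mathbb{R}_+^{n_1n_2}$, where $\mathbf{1}$ is the all-ones matrix. The largest eigenvalue of $M_1$ is $1$ (with eigenvector the all-ones vector), and it is known that $\eta>0$. Bregman projections of $\gamma\in\mathbb{R}_{+*}^{n_1n_2}$: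 $P_{\mathcal{C}_1}(\gamma)_{i,j}=\frac{(\mu_1)_i}{(A_1\gamma)_i}\gamma_{i,j}$ and $P_{\mathcal{C}_2}(\gamma)_{i,j}=\gamma_{i,j}\frac{(\mu_2)_j}{(A_2\gamma)_j}$. For $\omega\ge 0$, the $\omega$-relaxed projection $P^\omega_{\mathcal{C}_k}$ is defined by $\log P^\omega_{\mathcal{C}_k}(\gamma)=(1-\omega)\log\gamma+\omega\log P_{\mathcal{C}_k}(\gamma)$, with the logarithm taken entrywise. All iterates of these algorithms are diagonal scalings of $e^{-c/\varepsilon}$ (entrywise exponential), i.e. lie in $S=\{\mathrm{diag}(u)\,e^{-c/\varepsilon}\,\mathrm{diag}(v): u\in\mathbb{R}_{+*}^{n_1},v\in\mathbb{R}_{+*}^{n_2}\}$, and $\gamma^*\in S$. "Converges locally at the linear rate $\rho$" means: there is a neighborhood $U$ of $\gamma^*$ in $S$ such that, for every starting point in $U$, the iterates $\gamma^\ell$ converge to $\gamma^*$ and $\limsup_{\ell\to\infty}\|\gamma^\ell-\gamma^*\|^{1/\ell}\le\rho$. *)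

theory Defs
  imports "HOL-Analysis.Analysis" "HOL-Computational_Algebra.Polynomial"
begin

definition row_marginal :: "real^'n2^'n1 \<Rightarrow> real^'n1" where
  "row_marginal x = (\<chi> i. \<Sum>j\<in>UNIV. x $ i $ j)"

definition col_marginal :: "real^'n2^'n1 \<Rightarrow> real^'n2" where
  "col_marginal x = (\<chi> j. \<Sum>i\<in>UNIV. x $ i $ j)"

definition row_constraint :: "real^'n1 \<Rightarrow> (real^'n2^'n1) set" where
  "row_constraint \<mu>1 = {\<gamma>. row_marginal \<gamma> = \<mu>1}"

definition col_constraint :: "real^'n2 \<Rightarrow> (real^'n2^'n1) set" where
  "col_constraint \<mu>2 = {\<gamma>. col_marginal \<gamma> = \<mu>2}"

text \<open>The convention \<open>0 log 0 = 0\<close> needs no case distinction: \<open>ln 0\<close> is some real number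
  in HOL, and it is multiplied by \<open>0\<close>.\<close>

definition KL :: "real^'n2^'n1 \<Rightarrow> real^'n2^'n1 \<Rightarrow> real" where
  "KL \<gamma> \<zeta> = (\<Sum>i\<in>UNIV. \<Sum>j\<in>UNIV. \<gamma> $ i $ j * (ln (\<gamma> $ i $ j / \<zeta> $ i $ j) - 1))
            + (\<Sum>i\<in>UNIV. \<Sum>j\<in>UNIV. \<zeta> $ i $ j)"

definition entropic_cost :: "real^'n2^'n1 \<Rightarrow> real \<Rightarrow> real^'n2^'n1 \<Rightarrow> real" where
  "entropic_cost c \<epsilon> \<gamma> =
     (\<Sum>i\<in>UNIV. \<Sum>j\<in>UNIV. c $ i $ j * \<gamma> $ i $ j) + \<epsilon> * KL \<gamma> (\<chi> i j. 1)"

definition transport_plans :: "real^'n1 \<Rightarrow> real^'n2 \<Rightarrow> (real^'n2^'n1) set" where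
  "transport_plans \<mu>1 \<mu>2 =
     row_constraint \<mu>1 \<inter> col_constraint \<mu>2 \<inter> {\<gamma>. \<forall>i j. 0 \<le> \<gamma> $ i $ j}"

definition discrete_probability :: "real^'n \<Rightarrow> bool" where
  "discrete_probability \<mu> \<longleftrightarrow> (\<forall>i. 0 < \<mu> $ i) \<and> (\<Sum>i\<in>UNIV. \<mu> $ i) = 1"

definition row_projection :: "real^'n1 \<Rightarrow> real^'n2^'n1 \<Rightarrow> real^'n2^'n1" where
  "row_projection \<mu>1 \<gamma> = (\<chi> i j. \<mu>1 $ i / row_marginal \<gamma> $ i * \<gamma> $ i $ j)"

definition col_projection :: "real^'n2 \<Rightarrow> real^'n2^'n1 \<Rightarrow> real^'n2^'n1" where
  "col_projection \<mu>2 \<gamma> = (\<chi> i j. \<gamma> $ i $ j * (\<mu>2 $ j / col_marginal \<gamma> $ j))"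

text \<open>The matrix whose entrywise logarithm is \<open>(1 - \<omega>) log \<gamma> + \<omega> log (P \<gamma>)\<close>; only used
  where \<open>\<gamma>\<close> and \<open>P \<gamma>\<close> have positive entries.\<close>

definition relaxed ::
    "real \<Rightarrow> (real^'n2^'n1 \<Rightarrow> real^'n2^'n1) \<Rightarrow> real^'n2^'n1 \<Rightarrow> real^'n2^'n1" where
  "relaxed \<omega> P \<gamma> = (\<chi> i j. exp ((1 - \<omega>) * ln (\<gamma> $ i $ j) + \<omega> * ln (P \<gamma> $ i $ j)))"

definition overrelaxed_step ::
    "real^'n1 \<Rightarrow> real^'n2 \<Rightarrow> real \<Rightarrow> real^'n2^'n1 \<Rightarrow> real^'n2^'n1" where
  "overrelaxed_step \<mu>1 \<mu>2 \<theta> \<gamma> =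
     relaxed \<theta> (col_projection \<mu>2) (relaxed \<theta> (row_projection \<mu>1) \<gamma>)"

definition sinkhorn_knopp_step ::
    "real^'n1 \<Rightarrow> real^'n2 \<Rightarrow> real^'n2^'n1 \<Rightarrow> real^'n2^'n1" where
  "sinkhorn_knopp_step \<mu>1 \<mu>2 = overrelaxed_step \<mu>1 \<mu>2 1"

definition diag_matrix :: "real^'n \<Rightarrow> real^'n^'n" where
  "diag_matrix v = (\<chi> i j. if i = j then v $ i else 0)"

definition diagonal_scalings :: "real^'n2^'n1 \<Rightarrow> real \<Rightarrow> (real^'n2^'n1) set" where
  "diagonal_scalings c \<epsilon> =
     {diag_matrix u ** map_matrix (\<lambda>x. exp (- x / \<epsilon>)) c ** diag_matrix v | u v.
        (\<forall>i. 0 < u $ i) \<and> (\<forall>j. 0 < v $ j)}"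

definition converges_locally_at_rate ::
    "('a::real_normed_vector \<Rightarrow> 'a) \<Rightarrow> 'a set \<Rightarrow> 'a \<Rightarrow> real \<Rightarrow> bool" where
  "converges_locally_at_rate T S x \<rho> \<longleftrightarrow>
     (\<exists>U. openin (top_of_set S) U \<and> x \<in> U \<and>
       (\<forall>y\<in>U. (\<lambda>l. (T ^^ l) y) \<longlonglongrightarrow> x \<and>
          limsup (\<lambda>l. ereal (norm ((T ^^ l) y - x) powr (1 / real l))) \<le> ereal \<rho>))"

definition charpoly :: "real^'n^'n \<Rightarrow> real poly" where
  "charpoly A = det (mat [:0, 1:] - map_matrix (\<lambda>a. [:a:]) A)"

text \<open>Real eigenvalues are listed in decreasing order, each repeated according to its algebraic
  multiplicity. For a matrix with real spectrum and at least two rows the index 1 is in range.\<close>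

definition second_largest_eigenvalue :: "real^'n^'n \<Rightarrow> real" where
  "second_largest_eigenvalue A = rev (sorted_list_of_multiset (proots (charpoly A))) ! 1"

definition M1 :: "real^'n1 \<Rightarrow> real^'n2 \<Rightarrow> real^'n2^'n1 \<Rightarrow> real^'n1^'n1" where
  "M1 \<mu>1 \<mu>2 \<gamma> =
     diag_matrix (\<chi> i. 1 / \<mu>1 $ i) ** \<gamma> ** diag_matrix (\<chi> j. 1 / \<mu>2 $ j) ** transpose \<gamma>"

definition optimal_parameter :: "real \<Rightarrow> real" where
  "optimal_parameter \<eta> = 2 / (1 + sqrt \<eta>)"

definition rate :: "real \<Rightarrow> real \<Rightarrow> real" where
  "rate \<theta> \<eta> =
     (if \<theta> > optimal_parameter \<eta> then \<theta> - 1
      else 1 / 2 * \<theta>\<^sup>2 * (1 - \<eta>) - (\<theta> - 1)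
           + 1 / 2 * sqrt ((1 - \<eta>) * \<theta>\<^sup>2 * (\<theta>\<^sup>2 * (1 - \<eta>) - 4 * (\<theta> - 1))))"

end

theory Submission
  imports Defs "HOL-Real_Asymp.Real_Asymp"
begin

text \<open>
  Write an iterate as \<open>\<gamma> = \<gamma>s * exp X\<close> entrywise. The diagonal scalings then correspond to the matrices
  \<open>X\<close> with \<open>X i j = a i + b j\<close>, and in this coordinate the derivative of the iteration at the fixed point
  \<open>X = 0\<close> is \<open>(I - \<theta> E2) (I - \<theta> E1)\<close>, where \<open>E1\<close> and \<open>E2\<close> average over rows and columns with weights
  \<open>\<gamma>s\<close>. On functions of the row index \<open>E1 E2\<close> acts as \<open>M1\<close>, and the row averages \<open>z k\<close> of the linear
  iterates satisfy
  \<open>z (k + 2) = (2 (1 - \<theta>) + \<theta>\<^sup>2 M1) z (k + 1) - (1 - \<theta>)\<^sup>2 z k\<close>.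
  As \<open>M1\<close> is similar to a symmetric matrix, this decouples into scalar recurrences indexed by the
  eigenvalues \<open>s\<close> of \<open>M1\<close>. For \<open>s \<le> 1 - \<eta>\<close> the characteristic roots have modulus at most
  \<open>rate \<theta> \<eta>\<close>; the simple eigenvalue \<open>1\<close> belongs to the mean of \<open>X\<close>, which is multiplied by
  \<open>(1 - \<theta>)\<^sup>2\<close> in each step. Norms adapted to the linear part carry the rate over to the nonlinear
  iteration. That the minimizer is a positive diagonal scaling follows from perturbing it inside the
  transport polytope.
\<close>

section \<open>Diagonalization of real symmetric matrices\<close>

text \<open>A maximizer of the Rayleigh quotient on the unit sphere of \<open>S\<close>, which
  exists by compactness, is an eigenvector. Invariance keeps the residual in \<open>S\<close>, where
  it serves as a test direction.\<close>

lemma selfadjoint_eigenvector_exists: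
  fixes f :: "'a::euclidean_space \<Rightarrow> 'a"
  assumes f: "linear f" and sym: "\<And>x y. f x \<bullet> y = x \<bullet> f y"
    and S: "subspace S" and inv: "\<And>x. x \<in> S \<Longrightarrow> f x \<in> S" and ne: "dim S \<noteq> 0"
  obtains v l where "v \<in> S" "norm v = 1" "f v = l *\<^sub>R v"
proof -
  have "\<not> S \<subseteq> {0}" using ne by (simp add: dim_eq_0)
  then obtain u where u: "u \<in> S" "u \<noteq> 0" by auto
  have "(1 / norm u) *\<^sub>R u \<in> S \<inter> sphere 0 1"
    using u S by (auto simp: subspace_scale)
  moreover have "compact (S \<inter> sphere 0 1)"
    using S closed_subspace closed_Int_compact compact_sphere by blast
  moreover have "continuous_on (S \<inter> sphere 0 1) (\<lambda>x. x \<bullet> f x)"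
    by (intro continuous_intros linear_continuous_on) (use f linear_linear in blast)
  ultimately obtain v where "v \<in> S \<inter> sphere 0 1"
    and "\<forall>x\<in>S \<inter> sphere 0 1. x \<bullet> f x \<le> v \<bullet> f v"
    using continuous_attains_sup[of "S \<inter> sphere 0 1" "\<lambda>x. x \<bullet> f x"] by blast
  then have v: "v \<in> S" "norm v = 1"
    and max: "\<And>x. x \<in> S \<Longrightarrow> norm x = 1 \<Longrightarrow> x \<bullet> f x \<le> v \<bullet> f v"
    by auto
  define l where "l = v \<bullet> f v"
  have le: "x \<bullet> f x \<le> l * (x \<bullet> x)" if x: "x \<in> S" for x
  proof (cases "x = 0")
    case False
    have "((1 / norm x) *\<^sub>R x) \<bullet> f ((1 / norm x) *\<^sub>R x) \<le> l"
      unfolding l_def using False x S by (intro max) (auto simp: subspace_scale)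
    then show ?thesis
      using False by (simp add: linear_cmul[OF f] field_simps dot_square_norm power2_eq_square)
  qed simp
  define w where "w = f v - l *\<^sub>R v"
  have w: "w \<in> S" unfolding w_def using v S inv by (simp add: subspace_diff subspace_scale)
  define K where "K = l * (w \<bullet> w) - w \<bullet> f w"
  have vfw: "v \<bullet> f w = w \<bullet> f v" using sym[of w v] by (metis inner_commute)
  have ww: "w \<bullet> w = w \<bullet> f v - l * (w \<bullet> v)"
    by (subst (2) w_def) (simp only: inner_diff_right inner_scaleR_right)
  \<comment> \<open>The term linear in \<open>t\<close> is the squared norm of the residual
    \<open>w\<close>, so small positive \<open>t\<close> force \<open>w\<close> to vanish.\<close>
  have quad: "2 * t * (w \<bullet> w) \<le> t\<^sup>2 * K" for t
  proof -
    have "(v + t *\<^sub>R w) \<bullet> f (v + t *\<^sub>R w) \<le> l * ((v + t *\<^sub>R w) \<bullet> (v + t *\<^sub>R w))"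
      using v w S by (intro le) (simp add: subspace_add subspace_scale)
    moreover have "(v + t *\<^sub>R w) \<bullet> f (v + t *\<^sub>R w)
        = l + 2 * t * (w \<bullet> f v) + t\<^sup>2 * (w \<bullet> f w)"
      by (simp add: linear_add[OF f] linear_cmul[OF f] inner_add_left inner_add_right l_def
          algebra_simps power2_eq_square vfw)
    moreover have "(v + t *\<^sub>R w) \<bullet> (v + t *\<^sub>R w) = 1 + 2 * t * (w \<bullet> v) + t\<^sup>2 * (w \<bullet> w)"
      using v by (simp add: inner_add_left inner_add_right inner_commute[of v w] norm_eq_1
          algebra_simps power2_eq_square)
    ultimately have "l + 2 * t * (w \<bullet> f v) + t\<^sup>2 * (w \<bullet> f w)
        \<le> l * (1 + 2 * t * (w \<bullet> v) + t\<^sup>2 * (w \<bullet> w))"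
      by (simp only:)
    then have "2 * t * (w \<bullet> f v - l * (w \<bullet> v)) \<le> t\<^sup>2 * K"
      by (simp add: K_def algebra_simps)
    then show ?thesis by (simp only: ww[symmetric])
  qed
  have "w \<bullet> w = 0"
  proof (rule ccontr)
    assume "w \<bullet> w \<noteq> 0"
    then have pos: "w \<bullet> w > 0" by (simp add: less_le)
    \<comment> \<open>With this \<open>t\<close> the right side of \<open>quad\<close>, divided by
      \<open>t\<close>, is at most \<open>w \<bullet> w\<close>; the \<open>1\<close> excludes a
      zero denominator.\<close>
    define t where "t = (w \<bullet> w) / (\<bar>K\<bar> + 1)"
    have t: "t > 0" using pos by (simp add: t_def)
    have "2 * (w \<bullet> w) \<le> t * K" using quad[of t] t by (simp add: power2_eq_square)
    also have "\<dots> \<le> t * (\<bar>K\<bar> + 1)" using t by (intro mult_left_mono) auto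
    also have "\<dots> = w \<bullet> w" by (simp add: t_def)
    finally show False using pos by simp
  qed
  then have "f v = l *\<^sub>R v" by (simp add: w_def)
  with v show thesis using that by blast
qed

text \<open>Induction on the dimension: one unit eigenvector is split off, and self-adjointness
  makes its orthogonal complement in \<open>S\<close> invariant.\<close>

lemma selfadjoint_orthonormal_eigenbasis:
  fixes f :: "'a::euclidean_space \<Rightarrow> 'a"
  assumes f: "linear f" and sym: "\<And>x y. f x \<bullet> y = x \<bullet> f y"
    and S: "subspace S" and inv: "\<And>x. x \<in> S \<Longrightarrow> f x \<in> S"
  shows "\<exists>B\<subseteq>S. finite B \<and> card B = dim S \<and> pairwise orthogonal B
           \<and> (\<forall>v\<in>B. norm v = 1 \<and> (\<exists>l. f v = l *\<^sub>R v))"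
  using S inv
proof (induction "dim S" arbitrary: S)
  case 0
  then show ?case by (intro exI[of _ "{}"]) auto
next
  case (Suc n)
  obtain v l where v: "v \<in> S" "norm v = 1" "f v = l *\<^sub>R v"
    using selfadjoint_eigenvector_exists[of f S, OF f sym Suc.prems(1)] Suc.prems(2) Suc.hyps(2)
    by (metis Zero_not_Suc)
  define T where "T = {x \<in> S. v \<bullet> x = 0}"
  have "subspace T"
    using Suc.prems(1) by (auto simp: T_def subspace_def inner_add_right)
  moreover have "f x \<in> T" if "x \<in> T" for x
  proof -
    have "v \<bullet> f x = l * (v \<bullet> x)" by (simp add: sym[symmetric] v)
    then show ?thesis using that Suc.prems(2) by (simp add: T_def)
  qed
  moreover have "n = dim T"
  proof -
    have "T = {y \<in> S. \<forall>x\<in>span {v}. orthogonal x y}"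
      by (auto simp: T_def orthogonal_def span_singleton intro: bexI[of _ v])
    moreover have "span {v} \<subseteq> S" using v Suc.prems(1) by (simp add: span_minimal)
    ultimately have "dim T + dim (span {v}) = dim S"
      using dim_subspace_orthogonal_to_vectors[OF subspace_span Suc.prems(1), of "{v}"] by metis
    moreover have "v \<noteq> 0" using v by auto
    ultimately show ?thesis using Suc.hyps(2) by (simp add: dim_singleton)
  qed
  ultimately obtain B where B: "B \<subseteq> T" "finite B" "card B = dim T" "pairwise orthogonal B"
    "\<forall>v\<in>B. norm v = 1 \<and> (\<exists>l. f v = l *\<^sub>R v)"
    using Suc.hyps(1)[of T] by blast
  have "v \<notin> B" using B(1) v by (auto simp: T_def dot_square_norm)
  moreover have "pairwise orthogonal (insert v B)"
    using B(1,4) by (auto simp: pairwise_insert T_def orthogonal_def inner_commute)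
  ultimately show ?case
    using B v \<open>n = dim T\<close> Suc.hyps(2) by (intro exI[of _ "insert v B"]) (auto simp: T_def)
qed

section \<open>Diagonal matrices and orthogonal diagonalization\<close>

lemma matrix_mul_diag_matrix: "(A ** diag_matrix v) $ i $ j = A $ i $ j * v $ j"
  by (simp add: matrix_matrix_mult_def diag_matrix_def if_distrib cong: if_cong)

lemma diag_matrix_mul_matrix: "(diag_matrix u ** A) $ i $ j = u $ i * A $ i $ j"
  by (simp add: matrix_matrix_mult_def diag_matrix_def if_distrib[of "\<lambda>x. x * _"] cong: if_cong)

lemma diag_matrix_nth: "diag_matrix v $ i $ j = (if i = j then v $ i else 0)"
  by (simp add: diag_matrix_def)

lemma diag_matrix_mul_vec: "(diag_matrix u *v x) $ i = u $ i * x $ i"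
  by (simp add: matrix_vector_mult_def diag_matrix_def if_distrib[of "\<lambda>x. x * _"] cong: if_cong)

text \<open>The columns of \<open>Q\<close> are an orthonormal eigenbasis, indexed through the
  bijection \<open>h\<close>. With \<open>transpose Q\<close> acting from the left, the identity
  passes directly to coordinates of vectors.\<close>

theorem symmetric_matrix_diagonalizable:
  fixes A :: "real^'n^'n"
  assumes sym: "transpose A = A"
  obtains Q :: "real^'n^'n" and d where "transpose Q ** Q = mat 1" "Q ** transpose Q = mat 1"
    "transpose Q ** A = diag_matrix d ** transpose Q"
proof -
  have "(A *v x) \<bullet> y = x \<bullet> (A *v y)" for x y
    by (metis sym dot_lmul_matrix inner_commute transpose_matrix_vector)
  then obtain B where B: "finite B" "card B = DIM(real^'n)" "pairwise orthogonal B"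
    "\<forall>v\<in>B. norm v = 1 \<and> (\<exists>l. A *v v = l *\<^sub>R v)"
    using selfadjoint_orthonormal_eigenbasis[of "(*v) A" UNIV] by (auto simp: dim_UNIV)
  then obtain h where h: "bij_betw h (UNIV :: 'n set) B"
    using finite_same_card_bij[of "UNIV::'n set" B] by auto
  then have hB: "h i \<in> B" for i by (auto simp: bij_betw_def)
  then have "\<forall>i. \<exists>l. A *v h i = l *\<^sub>R h i"
    using B(4) by blast
  then obtain d where d: "\<And>i. A *v h i = d i *\<^sub>R h i"
    by metis
  have h_inner: "h i \<bullet> h j = (if i = j then 1 else 0)" for i j
  proof (cases "i = j")
    case True
    then show ?thesis using B(4) hB by (auto simp: dot_square_norm)
  next
    case False
    then have "h i \<noteq> h j" using h by (auto simp: bij_betw_def inj_on_def)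
    then show ?thesis using B(3) hB False by (auto simp: pairwise_def orthogonal_def)
  qed
  define Q where "Q = (\<chi> i j. h j $ i)"
  have 1: "transpose Q ** Q = mat 1"
    using h_inner by (simp add: vec_eq_iff matrix_matrix_mult_def transpose_def Q_def mat_def inner_vec_def)
  have "A ** Q = Q ** diag_matrix (\<chi> i. d i)"
  proof -
    have "(A ** Q) $ i $ j = (A *v h j) $ i" for i j
      by (simp add: matrix_matrix_mult_def matrix_vector_mult_def Q_def)
    then show ?thesis
      by (simp add: vec_eq_iff matrix_mul_diag_matrix d Q_def mult.commute)
  qed
  from arg_cong[OF this, of transpose]
  have "transpose Q ** A = transpose (diag_matrix (\<chi> i. d i)) ** transpose Q"
    by (simp only: matrix_transpose_mul sym)
  also have "transpose (diag_matrix (\<chi> i. d i)) = diag_matrix (\<chi> i. d i)"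
    by (auto simp: vec_eq_iff diag_matrix_def transpose_def)
  finally have "transpose Q ** A = diag_matrix (\<chi> i. d i) ** transpose Q" .
  moreover have "Q ** transpose Q = mat 1" using 1 by (simp add: matrix_left_right_inverse)
  ultimately show thesis
    using that[OF 1] by blast
qed

section \<open>Eigenvalues of diagonalizable matrices\<close>

lemma const_poly_sum: "[:sum f S:] = (\<Sum>x\<in>S. [:f x:])"
  by (auto simp: poly_eq_iff coeff_sum coeff_pCons split: nat.split)

text \<open>Embedding constants into polynomials is a ring homomorphism, so identities between
  matrices carry over to the polynomial matrices behind \<open>charpoly\<close>.\<close>

lemma map_matrix_const_poly_mult:
  fixes A :: "'a::comm_semiring_1^'m^'n" and B :: "'a^'k^'m"
  shows "map_matrix (\<lambda>a. [:a:]) (A ** B) = map_matrix (\<lambda>a. [:a:]) A ** map_matrix (\<lambda>a. [:a:]) B"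
  by (simp add: vec_eq_iff matrix_matrix_mult_def const_poly_sum mult.commute)

lemma map_matrix_const_poly_one:
  "map_matrix (\<lambda>a. [:a:]) (mat 1 :: 'a::comm_semiring_1^'n^'n) = mat 1"
  by (auto simp: vec_eq_iff mat_def)

lemma mat_mul_commute:
  fixes A :: "'a::comm_semiring_1^'n^'n"
  shows "mat x ** A = A ** mat x"
  by (simp add: vec_eq_iff matrix_matrix_mult_def mat_def mult.commute if_distrib[of "\<lambda>y. y * _"]
      if_distrib[of "\<lambda>y. _ * y"] cong: if_cong)

lemma matrix_mul_diff_right:
  fixes A :: "'a::ring_1^'m^'n" and B C :: "'a^'k^'m"
  shows "A ** (B - C) = A ** B - A ** C"
  by (simp add: vec_eq_iff matrix_matrix_mult_def right_diff_distrib sum_subtractf)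

lemma matrix_mul_diff_left:
  fixes A B :: "'a::ring_1^'m^'n" and C :: "'a^'k^'m"
  shows "(A - B) ** C = A ** C - B ** C"
  by (simp add: vec_eq_iff matrix_matrix_mult_def left_diff_distrib sum_subtractf)

lemma sum_single_mset: "finite S \<Longrightarrow> (\<Sum>x\<in>S. {#f x#}) = image_mset f (mset_set S)"
  by (induction S rule: finite_induct) auto

text \<open>A similarity remains one over the polynomial ring, so the characteristic polynomial is
  that of \<open>diag_matrix s\<close>, a product of linear factors. The multiset records
  multiplicities.\<close>

lemma proots_charpoly_diagonalizable:
  fixes A P P' :: "real^'n^'n"
  assumes inv: "P' ** P = mat 1" and diag: "P ** A = diag_matrix s ** P"
  shows "proots (charpoly A) = image_mset (($) s) (mset_set UNIV)"
proof -
  let ?C = "map_matrix (\<lambda>a::real. [:a:])"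
  have "?C P ** (mat [:0, 1:] - ?C A) = ?C P ** mat [:0, 1:] - ?C (P ** A)"
    by (simp add: matrix_mul_diff_right map_matrix_const_poly_mult)
  also have "\<dots> = (mat [:0, 1:] - ?C (diag_matrix s)) ** ?C P"
    by (simp add: matrix_mul_diff_left diag mat_mul_commute map_matrix_const_poly_mult)
  finally have "det (?C P) * charpoly A = det (mat [:0, 1:] - ?C (diag_matrix s)) * det (?C P)"
    by (metis det_mul charpoly_def)
  \<comment> \<open>Hence \<open>det (?C P)\<close> is nonzero and cancels in the integral domain of
    real polynomials.\<close>
  moreover have "det (?C P') * det (?C P) = 1"
    by (metis det_mul det_I inv map_matrix_const_poly_mult map_matrix_const_poly_one)
  ultimately have "charpoly A = det (mat [:0, 1:] - ?C (diag_matrix s))"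
    by (metis mult.commute mult_cancel_left mult_zero_right zero_neq_one)
  also have "\<dots> = (\<Prod>i\<in>UNIV. [:- (s $ i), 1:])"
    by (subst det_diagonal) (auto simp: mat_def diag_matrix_def)
  finally have "proots (charpoly A) = (\<Sum>i\<in>UNIV. proots [:- (s $ i), 1:])"
    by (simp add: proots_prod)
  then show ?thesis by (simp add: sum_single_mset)
qed

text \<open>Removing one copy of the top value \<open>s i0\<close> leaves the multiset
  \<open>R\<close>, whose maximum is entry 1 of the decreasing list. Only one copy goes, so ties
  with the top value are covered.\<close>

lemma second_largest_eigenvalue_characterization:
  fixes A :: "real^'n^'n"
  fixes s :: "'n \<Rightarrow> real"
  assumes roots: "proots (charpoly A) = image_mset s (mset_set UNIV)" and n: "CARD('n) \<ge> 2"
    and le: "\<And>i. s i \<le> s i0"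
  shows "\<exists>i. i \<noteq> i0 \<and> s i = second_largest_eigenvalue A"
    and "i \<noteq> i0 \<Longrightarrow> s i \<le> second_largest_eigenvalue A"
proof -
  define R where "R = image_mset s (mset_set (UNIV - {i0}))"
  define xs where "xs = sorted_list_of_multiset R"
  have set_xs: "set xs = s ` (UNIV - {i0})" by (simp add: xs_def R_def finite_set_mset_mset_set)
  have "UNIV - {i0} \<noteq> {}"
  proof
    assume "UNIV - {i0} = {}"
    then have "(UNIV :: 'n set) = {i0}" by auto
    from arg_cong[OF this, of card] have "CARD('n) = 1" by simp
    then show False using n by simp
  qed
  then obtain ys m where ys: "xs = ys @ [m]"
    using set_xs by (cases xs rule: rev_cases) auto
  have "mset_set (UNIV :: 'n set) = add_mset i0 (mset_set (UNIV - {i0}))"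
    using mset_set.remove[of "UNIV :: 'n set" i0] by simp
  then have "proots (charpoly A) = add_mset (s i0) R"
    by (simp add: roots R_def)
  then have "sorted_list_of_multiset (proots (charpoly A)) = insort (s i0) xs"
    by (simp add: xs_def)
  also have "\<dots> = xs @ [s i0]"
    using le by (intro sorted_insort_is_snoc) (auto simp: set_xs xs_def[symmetric]
        intro: sorted_sorted_list_of_multiset[of R, folded xs_def])
  finally have sle: "second_largest_eigenvalue A = m"
    by (simp add: second_largest_eigenvalue_def ys)
  have "m \<in> s ` (UNIV - {i0})" using ys by (simp flip: set_xs)
  then show "\<exists>i. i \<noteq> i0 \<and> s i = second_largest_eigenvalue A" by (auto simp: sle)
  have "sorted xs" by (simp add: xs_def)
  then have "x \<le> m" if "x \<in> set xs" for x
    using that by (auto simp: ys sorted_append)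
  then show "s i \<le> second_largest_eigenvalue A" if "i \<noteq> i0"
    using that by (simp add: sle set_xs)
qed

section \<open>The rate function and scalar second-order recurrences\<close>

text \<open>The characteristic polynomial of the scalar recurrence at \<open>s = 1 - \<eta>\<close>
  is \<open>(r + \<theta> - 1)\<^sup>2 - \<theta>\<^sup>2 * (1 - \<eta>) * r\<close>. Up to
  \<open>optimal_parameter \<eta>\<close> its roots are real and \<open>rate\<close> is the larger
  one; beyond, both have modulus \<open>\<theta> - 1\<close>.\<close>

lemma rate_properties:
  assumes \<eta>: "0 < \<eta>" "\<eta> \<le> 1" and \<theta>: "0 < \<theta>" "\<theta> < 2"
  shows rate_ge: "\<bar>1 - \<theta>\<bar> \<le> rate \<theta> \<eta>"
    and rate_less_1: "rate \<theta> \<eta> < 1"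
    and rate_ge_if: "\<theta> \<le> optimal_parameter \<eta>
      \<Longrightarrow> (r + \<theta> - 1)\<^sup>2 \<le> \<theta>\<^sup>2 * (1 - \<eta>) * r \<Longrightarrow> r \<le> rate \<theta> \<eta>"
    and rate_less_imp: "rate \<theta> \<eta> < r \<Longrightarrow> \<theta>\<^sup>2 * (1 - \<eta>) * r \<le> (r + \<theta> - 1)\<^sup>2"
proof -
  define e where "e = sqrt \<eta>"
  have e: "0 < e" "e \<le> 1" "e\<^sup>2 = \<eta>" using \<eta> by (auto simp: e_def)
  define d where "d = \<theta>\<^sup>2 * (1 - \<eta>) - 4 * (\<theta> - 1)"
  define \<alpha> where "\<alpha> = 2 * (1 - \<theta>) + \<theta>\<^sup>2 * (1 - \<eta>)"
  \<comment> \<open>The second factor is always positive, so the first decides the sign of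
    \<open>d\<close>; it vanishes exactly at \<open>optimal_parameter \<eta>\<close>.\<close>
  have d_eq: "d = (2 - \<theta> * (1 + e)) * (2 - \<theta> * (1 - e))"
    by (simp add: d_def e(3)[symmetric] power2_eq_square algebra_simps)
  have "\<theta> * (1 - e) < 2 * 1" using \<theta> e by (intro mult_strict_mono) auto
  then have d_pos: "0 < 2 - \<theta> * (1 - e)" by simp
  have disc: "\<alpha>\<^sup>2 - 4 * (1 - \<theta>)\<^sup>2 = \<theta>\<^sup>2 * (1 - \<eta>) * d"
    by (simp add: \<alpha>_def d_def power2_eq_square algebra_simps)
  have quad: "(r + \<theta> - 1)\<^sup>2 - \<theta>\<^sup>2 * (1 - \<eta>) * r = ((2 * r - \<alpha>)\<^sup>2 - (\<alpha>\<^sup>2 - 4 * (1 - \<theta>)\<^sup>2)) / 4" for r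
    by (simp add: \<alpha>_def power2_eq_square field_simps)
  have opt: "\<theta> > optimal_parameter \<eta> \<longleftrightarrow> 2 < \<theta> * (1 + e)"
    using e by (simp add: optimal_parameter_def e_def[symmetric] divide_less_eq)
  have s0: "0 \<le> \<theta>\<^sup>2 * (1 - \<eta>)" using \<eta> by simp
  have "\<theta> * (1 - \<eta>) < 2 * 1" using \<theta> \<eta> by (intro mult_strict_mono) auto
  then have "\<theta> * (\<theta> * (1 - \<eta>)) < \<theta> * 2" using \<theta> by simp
  then have \<alpha>2: "\<alpha> < 2" by (simp add: \<alpha>_def power2_eq_square algebra_simps)
  have "\<bar>1 - \<theta>\<bar> \<le> rate \<theta> \<eta> \<and> rate \<theta> \<eta> < 1 \<and>
    (\<theta> \<le> optimal_parameter \<eta> \<longrightarrow> (r + \<theta> - 1)\<^sup>2 \<le> \<theta>\<^sup>2 * (1 - \<eta>) * r \<longrightarrow> r \<le> rate \<theta> \<eta>) \<and>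
    (rate \<theta> \<eta> < r \<longrightarrow> \<theta>\<^sup>2 * (1 - \<eta>) * r \<le> (r + \<theta> - 1)\<^sup>2)" for r
  proof (cases "\<theta> > optimal_parameter \<eta>")
    case True
    then have "2 - \<theta> * (1 + e) < 0" using opt by simp
    then have "d \<le> 0" using d_pos unfolding d_eq by (simp add: mult_le_0_iff)
    then have "\<theta>\<^sup>2 * (1 - \<eta>) * d \<le> 0" using s0 by (simp add: mult_le_0_iff)
    then have "0 \<le> (r + \<theta> - 1)\<^sup>2 - \<theta>\<^sup>2 * (1 - \<eta>) * r"
      unfolding quad disc
      using order_trans[OF _ zero_le_power2] by (simp add: add_nonneg_nonneg)
    moreover have "\<theta> \<ge> 1" using \<open>d \<le> 0\<close> s0 by (simp add: d_def)
    ultimately show ?thesis using True \<theta> by (simp add: rate_def)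
  next
    case False
    then have "0 \<le> 2 - \<theta> * (1 + e)" using opt by simp
    then have d0: "0 \<le> d" unfolding d_eq using d_pos by (intro mult_nonneg_nonneg) auto
    define R where "R = sqrt (\<alpha>\<^sup>2 - 4 * (1 - \<theta>)\<^sup>2)"
    have nn: "0 \<le> \<alpha>\<^sup>2 - 4 * (1 - \<theta>)\<^sup>2" unfolding disc using s0 d0 by (rule mult_nonneg_nonneg)
    have R: "R\<^sup>2 = \<alpha>\<^sup>2 - 4 * (1 - \<theta>)\<^sup>2" "0 \<le> R" using nn by (auto simp: R_def)
    have rate: "rate \<theta> \<eta> = (\<alpha> + R) / 2"
      using False unfolding rate_def R_def disc by (simp add: \<alpha>_def d_def field_simps)
    have "2 * (1 - \<theta>) \<le> \<alpha>" using s0 by (simp add: \<alpha>_def)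
    moreover have "2 * (\<theta> - 1) \<le> \<alpha>" using d0 by (simp add: \<alpha>_def d_def)
    ultimately have "\<bar>1 - \<theta>\<bar> \<le> rate \<theta> \<eta>" using R(2) unfolding rate
      by (intro abs_leI) (simp_all add: field_simps)
    moreover have "rate \<theta> \<eta> < 1"
    proof -
      \<comment> \<open>At 1 the quadratic equals \<open>\<theta>\<^sup>2 * \<eta>\<close>; as its
        vertex \<open>\<alpha> / 2\<close> lies below 1, so do both roots.\<close>
      have "0 < (1 + \<theta> - 1)\<^sup>2 - \<theta>\<^sup>2 * (1 - \<eta>) * 1" using \<theta> \<eta> by (simp add: algebra_simps)
      then have "R\<^sup>2 < (2 - \<alpha>)\<^sup>2" unfolding quad R(1) by simp
      then have "R < 2 - \<alpha>" by (rule power2_less_imp_less) (use \<alpha>2 in simp)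
      then show ?thesis by (simp add: rate)
    qed
    moreover have "\<theta>\<^sup>2 * (1 - \<eta>) * r \<le> (r + \<theta> - 1)\<^sup>2" if "rate \<theta> \<eta> < r"
    proof -
      have "R \<le> 2 * r - \<alpha>" using that by (simp add: rate)
      then have "R\<^sup>2 \<le> (2 * r - \<alpha>)\<^sup>2" using R(2) by (intro power_mono)
      then have "0 \<le> (r + \<theta> - 1)\<^sup>2 - \<theta>\<^sup>2 * (1 - \<eta>) * r" unfolding quad R(1) by simp
      then show ?thesis by simp
    qed
    moreover have "r \<le> rate \<theta> \<eta>" if "(r + \<theta> - 1)\<^sup>2 \<le> \<theta>\<^sup>2 * (1 - \<eta>) * r"
    proof -
      have "(2 * r - \<alpha>)\<^sup>2 \<le> R\<^sup>2" using that quad[of r] R(1) by simp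
      then have "2 * r - \<alpha> \<le> R" using R(2) by (rule power2_le_imp_le)
      then show ?thesis by (simp add: rate)
    qed
    ultimately show ?thesis by blast
  qed
  then show "\<bar>1 - \<theta>\<bar> \<le> rate \<theta> \<eta>" "rate \<theta> \<eta> < 1"
    "\<theta> \<le> optimal_parameter \<eta> \<Longrightarrow> (r + \<theta> - 1)\<^sup>2 \<le> \<theta>\<^sup>2 * (1 - \<eta>) * r \<Longrightarrow> r \<le> rate \<theta> \<eta>"
    "rate \<theta> \<eta> < r \<Longrightarrow> \<theta>\<^sup>2 * (1 - \<eta>) * r \<le> (r + \<theta> - 1)\<^sup>2"
    by blast+
qed

lemma optimal_parameter_bounds:
  assumes "0 < \<eta>" "\<eta> \<le> 1"
  shows "1 \<le> optimal_parameter \<eta>" "optimal_parameter \<eta> < 2"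
  using assms by (auto simp: optimal_parameter_def field_simps add_pos_pos)

lemma rate_1:
  assumes "0 < \<eta>" "\<eta> \<le> 1"
  shows "rate 1 \<eta> = 1 - \<eta>"
  using assms optimal_parameter_bounds[OF assms] by (simp add: rate_def real_sqrt_mult[symmetric])

lemma optimal_parameter_minus_1:
  assumes "0 < \<eta>"
  shows "optimal_parameter \<eta> - 1 = (1 - sqrt \<eta>) / (1 + sqrt \<eta>)"
proof -
  have "1 + sqrt \<eta> \<noteq> 0" using assms real_sqrt_gt_zero[of \<eta>] by linarith
  then show ?thesis by (simp add: optimal_parameter_def field_simps)
qed

text \<open>At this parameter the discriminant vanishes and the two characteristic roots merge at
  \<open>optimal_parameter \<eta> - 1\<close>.\<close>

lemma rate_optimal:
  assumes "0 < \<eta>" "\<eta> \<le> 1"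
  shows "rate (optimal_parameter \<eta>) \<eta> = (1 - sqrt \<eta>) / (1 + sqrt \<eta>)"
proof -
  define e t where "e = sqrt \<eta>" and "t = optimal_parameter \<eta>"
  have e: "0 < e" "e\<^sup>2 = \<eta>" using assms by (auto simp: e_def)
  have "1 + e \<noteq> 0" using e by linarith
  then have "t * (1 + e) = 2" 
    using nonzero_eq_divide_eq[of "1 + e" t 2] by (simp add: t_def optimal_parameter_def e_def)
  moreover have "t\<^sup>2 * (1 - \<eta>) - 4 * (t - 1) = (2 - t * (1 + e)) * (2 - t * (1 - e))"
    by (simp add: e(2)[symmetric] power2_eq_square algebra_simps)
  ultimately have "t\<^sup>2 * (1 - \<eta>) = 4 * (t - 1)" by simp
  then have "rate t \<eta> = t - 1"
    by (simp add: rate_def t_def[symmetric] diff_divide_distrib)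
  then show ?thesis using optimal_parameter_minus_1[OF assms(1)] by (simp add: t_def)
qed

text \<open>Instead of differentiating in \<theta>, the main case shows that the characteristic
  quadratic is nonpositive at the candidate \<open>r\<close>, which therefore does not exceed the
  larger root.\<close>

lemma rate_optimal_le:
  assumes \<eta>: "0 < \<eta>" "\<eta> \<le> 1" and \<theta>: "0 < \<theta>" "\<theta> < 2"
  shows "rate (optimal_parameter \<eta>) \<eta> \<le> rate \<theta> \<eta>"
proof -
  define e r where "e = sqrt \<eta>" and "r = rate (optimal_parameter \<eta>) \<eta>"
  have e: "0 < e" "e \<le> 1" "e\<^sup>2 = \<eta>" using \<eta> by (auto simp: e_def)
  have r: "r = (1 - e) / (1 + e)" using rate_optimal[OF \<eta>] by (simp add: r_def e_def)
  have r1: "(1 + e) * r = 1 - e" using e by (simp add: r)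
  have r_opt: "r = optimal_parameter \<eta> - 1"
    using optimal_parameter_minus_1[OF \<eta>(1)] by (simp add: r e_def)
  \<comment> \<open>The second case is split off so that \<open>r + \<theta> - 1\<close> is positive
    in the third, where it gets squared.\<close>
  consider "\<theta> > optimal_parameter \<eta>" | "r \<le> 1 - \<theta>" | "\<theta> \<le> optimal_parameter \<eta>" "1 - \<theta> < r"
    by linarith
  then have "r \<le> rate \<theta> \<eta>"
  proof cases
    case 1
    then show ?thesis by (simp add: r_opt rate_def)
  next
    case 2
    then show ?thesis using rate_ge[OF \<eta> \<theta>] by linarith
  next
    case 3
    have "e * \<theta> \<le> e * (r + 1)" using 3 e by (intro mult_left_mono) (auto simp: r_opt)
    also have "\<dots> = 1 - r" using r1 by (simp add: algebra_simps)
    finally have "r + \<theta> - 1 \<le> \<theta> * (1 - e)" by (simp add: algebra_simps)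
    then have "(r + \<theta> - 1)\<^sup>2 \<le> (\<theta> * (1 - e))\<^sup>2" using 3 by (intro power_mono) auto
    also have "\<dots> = \<theta>\<^sup>2 * ((1 - e) * ((1 + e) * r))" by (simp add: r1 power_mult_distrib power2_eq_square)
    also have "\<dots> = \<theta>\<^sup>2 * (1 - \<eta>) * r" by (simp add: e(3)[symmetric] power2_eq_square algebra_simps)
    finally show ?thesis using rate_ge_if[OF \<eta> \<theta> 3(1)] by blast
  qed
  then show ?thesis by (simp add: r_def)
qed

text \<open>The last hypothesis says that the quadratic is nonnegative at both \<open>r\<close> and
  \<open>- r\<close>. A nonreal root has squared modulus \<open>\<beta>\<close>; a real root beyond
  \<open>r\<close> would push \<open>\<beta>\<close>, the product of the roots, above
  \<open>r\<^sup>2\<close>.\<close>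

lemma quadratic_root_bound:
  fixes z :: complex and \<alpha> \<beta> r :: real
  assumes z: "z\<^sup>2 - of_real \<alpha> * z + of_real \<beta> = 0"
    and r: "0 < r" "\<bar>\<beta>\<bar> \<le> r\<^sup>2" "\<bar>\<alpha>\<bar> * r \<le> r\<^sup>2 + \<beta>"
  shows "cmod z \<le> r"
proof -
  have re: "(Re z)\<^sup>2 - (Im z)\<^sup>2 - \<alpha> * Re z + \<beta> = 0" and im: "2 * Re z * Im z - \<alpha> * Im z = 0"
    using arg_cong[OF z, of Re] arg_cong[OF z, of Im] by (simp_all add: power2_eq_square)
  show ?thesis
  proof (cases "Im z = 0")
    case False
    then have "\<alpha> = 2 * Re z" using im by (simp flip: left_diff_distrib)
    then have "(cmod z)\<^sup>2 = \<beta>"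
      unfolding cmod_power2 using re by (simp add: power2_eq_square algebra_simps)
    then have "(cmod z)\<^sup>2 \<le> r\<^sup>2" using r by simp
    then show ?thesis using r by (auto intro: power2_le_imp_le)
  next
    case True
    define x where "x = \<bar>Re z\<bar>"
    have "cmod z = x" using True by (simp add: cmod_def x_def)
    moreover have "x \<le> r"
    proof (rule ccontr)
      assume "\<not> x \<le> r"
      then have x: "r < x" by simp
      then have "r * r < x * x" using r by (intro mult_strict_mono) auto
      then have "\<bar>\<alpha> * Re z\<bar> = x\<^sup>2 + \<beta>"
        using re True r by (simp add: x_def power2_eq_square)
      then have "\<bar>\<alpha>\<bar> * x = x\<^sup>2 + \<beta>" by (simp add: abs_mult x_def)
      then have "r * (x\<^sup>2 + \<beta>) = x * (\<bar>\<alpha>\<bar> * r)" by (metis mult.assoc mult.commute)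
      also have "\<dots> \<le> x * (r\<^sup>2 + \<beta>)" using r x by (intro mult_left_mono) auto
      finally have "(r * x) * (x - r) \<le> \<beta> * (x - r)" by (simp add: power2_eq_square algebra_simps)
      then have "r * x \<le> \<beta>" using x by simp
      moreover have "\<beta> \<le> r * r" using r(2) by (simp add: power2_eq_square abs_le_iff)
      ultimately have "r * x \<le> r * r" by linarith
      then show False using x r(1) by simp
    qed
    ultimately show ?thesis by simp
  qed
qed

text \<open>The summand with factor \<open>k\<close> accounts for a double characteristic root; no
  division by the difference of the roots occurs, so the estimate does not degenerate when they
  merge.\<close>

lemma second_order_recurrence_bound:
  fixes x :: "nat \<Rightarrow> real"
  assumes rec: "\<And>k. x (Suc (Suc k)) = \<alpha> * x (Suc k) - \<beta> * x k"
    and r: "0 < r" "\<bar>\<beta>\<bar> \<le> r\<^sup>2" "\<bar>\<alpha>\<bar> * r \<le> r\<^sup>2 + \<beta>"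
  shows "\<bar>x k\<bar> \<le> r ^ k * (\<bar>x 0\<bar> + real k * (\<bar>x 0\<bar> + \<bar>x 1\<bar> / r))"
proof -
  text \<open>Factor the recurrence over the complex numbers: \<open>y k = x (k + 1) - a * x k\<close> is geometric with
    ratio \<open>b\<close>, where \<open>a\<close> and \<open>b\<close> are the characteristic roots.\<close>
  define D :: complex where "D = csqrt (of_real (\<alpha>\<^sup>2 - 4 * \<beta>))"
  define a b where "a = (of_real \<alpha> + D) / 2" and "b = (of_real \<alpha> - D) / 2"
  have "D\<^sup>2 = of_real (\<alpha>\<^sup>2 - 4 * \<beta>)" unfolding D_def by (rule power2_csqrt)
  then have D: "D * D = of_real \<alpha> * of_real \<alpha> - 4 * of_real \<beta>" by (simp add: power2_eq_square)
  have ab: "a + b = of_real \<alpha>" "a * b = of_real \<beta>"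
    using D by (simp_all add: a_def b_def field_simps)
  have "a\<^sup>2 - of_real \<alpha> * a + of_real \<beta> = 0" "b\<^sup>2 - of_real \<alpha> * b + of_real \<beta> = 0"
    unfolding ab[symmetric] by (simp_all add: power2_eq_square algebra_simps)
  then have ar: "cmod a \<le> r" "cmod b \<le> r"
    using quadratic_root_bound[OF _ r] by blast+
  define y where "y k = complex_of_real (x (Suc k)) - a * of_real (x k)" for k
  have y_Suc: "y (Suc k) = b * y k" for k
    unfolding y_def rec of_real_diff of_real_mult ab[symmetric] by (simp add: algebra_simps)
  have y_bound: "cmod (y k) \<le> r ^ k * (\<bar>x 1\<bar> + r * \<bar>x 0\<bar>)" for k
  proof (induction k)
    case 0
    have "cmod (y 0) \<le> cmod (of_real (x 1)) + cmod (a * of_real (x 0))"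
      unfolding y_def One_nat_def by (rule norm_triangle_ineq4)
    also have "\<dots> \<le> \<bar>x 1\<bar> + r * \<bar>x 0\<bar>"
      using ar by (simp add: norm_mult mult_right_mono)
    finally show ?case by simp
  next
    case (Suc k)
    have "cmod (y (Suc k)) \<le> r * (r ^ k * (\<bar>x 1\<bar> + r * \<bar>x 0\<bar>))"
      unfolding y_Suc norm_mult using ar(2) Suc r by (intro mult_mono) auto
    then show ?case by (simp add: mult_ac)
  qed
  show ?thesis
  proof (induction k)
    case (Suc k)
    have "\<bar>x (Suc k)\<bar> = cmod (a * of_real (x k) + y k)"
      by (simp add: y_def)
    also have "\<dots> \<le> r * \<bar>x k\<bar> + r ^ k * (\<bar>x 1\<bar> + r * \<bar>x 0\<bar>)"
      using ar(1) y_bound[of k]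
      by (intro order_trans[OF norm_triangle_ineq] add_mono) (auto simp: norm_mult mult_right_mono)
    also have "\<dots> \<le> r * (r ^ k * (\<bar>x 0\<bar> + real k * (\<bar>x 0\<bar> + \<bar>x 1\<bar> / r)))
        + r ^ k * (\<bar>x 1\<bar> + r * \<bar>x 0\<bar>)"
      using Suc r by (intro add_mono mult_left_mono) auto
    also have "\<dots> = r ^ Suc k * (\<bar>x 0\<bar> + real (Suc k) * (\<bar>x 0\<bar> + \<bar>x 1\<bar> / r))"
      using r by (simp add: field_simps)
    finally show ?case .
  qed simp
qed

section \<open>Local linear convergence from the derivative\<close>

text \<open>The bound on one power makes \<open>L\<close> contract by \<open>p\<close> in an
  equivalent norm; near 0 the gap \<open>q - p\<close> absorbs the error of linearization.
  \<open>K\<close> measures the equivalence of the norms.\<close>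

lemma local_contraction_of_linear_part:
  fixes T L :: "'a::real_normed_vector \<Rightarrow> 'a"
  assumes V: "subspace V" and TV: "\<And>x. x \<in> V \<Longrightarrow> T x \<in> V"
    and T0: "T 0 = 0" and deriv: "(T has_derivative L) (at 0)"
    and q: "0 < p" "p < q" "q < 1"
    and m: "m \<noteq> 0" "\<And>x. x \<in> V \<Longrightarrow> norm ((L ^^ m) x) \<le> p ^ m * norm x"
  obtains \<delta> K where "0 < \<delta>" "0 < K"
    "\<And>x l. x \<in> V \<Longrightarrow> norm x < \<delta> \<Longrightarrow> norm ((T ^^ l) x) \<le> K * q ^ l * norm x"
proof -
  have L: "bounded_linear L" using deriv by (rule has_derivative_bounded_linear)
  have Lk: "bounded_linear (L ^^ k)" for k
  proof (induction k)
    case 0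
    then show ?case by (simp add: bounded_linear_ident id_def)
  next
    case (Suc k)
    then show ?case using bounded_linear_compose[OF L] by (simp add: o_def)
  qed
  text \<open>The adapted norm \<open>N\<close> is contracted by \<open>L\<close> itself, not only by \<open>L ^^ m\<close>.\<close>
  define N where "N x = (\<Sum>k<m. norm ((L ^^ k) x) / p ^ k)" for x
  have "\<forall>k. \<exists>B>0. \<forall>x. norm ((L ^^ k) x) \<le> norm x * B"
    using bounded_linear.pos_bounded[OF Lk] by blast
  then obtain B where B: "\<And>k. B k > 0" "\<And>k x. norm ((L ^^ k) x) \<le> norm x * B k"
    by metis
  define K where "K = (\<Sum>k<m. B k / p ^ k)"
  have K: "0 < K" unfolding K_def using m(1) B(1) q by (intro sum_pos) auto
  have N_le: "N x \<le> K * norm x" for x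
    unfolding N_def K_def sum_distrib_right using B(2)[of _ x] q
    by (intro sum_mono) (simp add: divide_right_mono mult.commute)
  have le_N: "norm x \<le> N x" for x
  proof -
    have "norm ((L ^^ 0) x) / p ^ 0 \<le> N x"
      unfolding N_def using m(1) q by (intro member_le_sum) auto
    then show ?thesis by simp
  qed
  have N_add: "N (x + y) \<le> N x + N y" for x y
    unfolding N_def sum.distrib[symmetric] using q
    by (intro sum_mono)
      (simp add: linear_add[OF bounded_linear.linear[OF Lk]] add_divide_distrib[symmetric] divide_right_mono norm_triangle_ineq)
  \<comment> \<open>The difference telescopes, leaving only the power \<open>m\<close>, to which the
    hypothesis applies.\<close>
  have N_L: "N (L x) \<le> p * N x" if "x \<in> V" for x
  proof -
    have "p * N x - N (L x) = p * (\<Sum>k<m. norm ((L ^^ k) x) / p ^ k - norm ((L ^^ Suc k) x) / p ^ Suc k)"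
      unfolding N_def sum_distrib_left sum_subtractf[symmetric] using q
      by (intro sum.cong refl) (simp add: funpow_swap1 field_simps)
    also have "\<dots> = p * (norm x - norm ((L ^^ m) x) / p ^ m)"
      by (subst sum_lessThan_telescope') simp
    also have "\<dots> \<ge> 0" using m(2)[OF that] q by (simp add: divide_le_eq mult.commute)
    finally show ?thesis by simp
  qed
  \<comment> \<open>Dividing by \<open>K\<close> compensates for the passage from the given norm to
    \<open>N\<close>.\<close>
  have "(q - p) / K > 0" using q K by simp
  then obtain \<delta> where \<delta>: "0 < \<delta>"
    "\<And>x. norm x < \<delta> \<Longrightarrow> norm (T x - L x) \<le> (q - p) / K * norm x"
    using deriv T0 unfolding has_derivative_at_alt by (metis diff_zero linear_simps(3)[OF L])
  have N_T: "N (T x) \<le> q * N x" if "x \<in> V" "norm x < \<delta>" for x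
  proof -
    have "N (T x) \<le> N (L x) + N (T x - L x)" using N_add[of "L x" "T x - L x"] by simp
    also have "\<dots> \<le> p * N x + K * ((q - p) / K * norm x)"
      using N_L[OF that(1)] order_trans[OF N_le[of "T x - L x"] mult_left_mono[OF \<delta>(2)[OF that(2)]]] K
      by (intro add_mono) auto
    also have "\<dots> = p * N x + (q - p) * norm x" using K by simp
    also have "\<dots> \<le> p * N x + (q - p) * N x" using le_N q by (intro add_mono mult_left_mono) auto
    finally show ?thesis by (simp add: algebra_simps)
  qed
  \<comment> \<open>Smallness is measured in \<open>N\<close>, which does not increase along the
    orbit, so the local estimate applies at every step.\<close>
  have iter: "(T ^^ l) x \<in> V \<and> N ((T ^^ l) x) \<le> q ^ l * N x" if x: "x \<in> V" "N x < \<delta>" for x l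
  proof (induction l)
    case (Suc l)
    have "N ((T ^^ l) x) \<le> 1 * N x"
      using Suc q order_trans[OF norm_ge_zero le_N[of x]]
      by (intro order_trans[OF conjunct2[OF Suc]] mult_right_mono) (auto simp: power_le_one)
    then have "norm ((T ^^ l) x) < \<delta>" using le_N[of "(T ^^ l) x"] x by simp
    then have "N (T ((T ^^ l) x)) \<le> q * N ((T ^^ l) x)" using N_T Suc by blast
    also have "\<dots> \<le> q * (q ^ l * N x)" using Suc q by (intro mult_left_mono) auto
    finally show ?case using Suc TV by (simp add: mult.assoc)
  qed (use x in simp)
  show thesis
  proof (rule that[of "\<delta> / K" K])
    show "0 < \<delta> / K" "0 < K" using \<delta> K by auto
    fix x l assume x: "x \<in> V" "norm x < \<delta> / K"
    then have "N x < \<delta>" using N_le[of x] K by (simp add: field_simps)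
    then have "norm ((T ^^ l) x) \<le> q ^ l * N x"
      using iter[OF x(1)] le_N[of "(T ^^ l) x"] by (meson order_trans)
    also have "\<dots> \<le> q ^ l * (K * norm x)" using N_le q by (intro mult_left_mono) auto
    finally show "norm ((T ^^ l) x) \<le> K * q ^ l * norm x" by (simp add: mult_ac)
  qed
qed

text \<open>The radius must not depend on \<open>q\<close>: the fixed rate \<open>q0\<close> first
  brings the orbit into the smaller ball where the estimate for \<open>q\<close> holds. Hence the
  bound is only eventual, with a constant depending on \<open>x\<close> and
  \<open>q\<close>.\<close>

theorem local_linear_convergence:
  fixes T L :: "'a::real_normed_vector \<Rightarrow> 'a"
  assumes V: "subspace V" and TV: "\<And>x. x \<in> V \<Longrightarrow> T x \<in> V"
    and T0: "T 0 = 0" and deriv: "(T has_derivative L) (at 0)"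
    and \<rho>: "0 \<le> \<rho>" "\<rho> < 1"
    and pow: "\<And>q. \<rho> < q \<Longrightarrow> q < 1 \<Longrightarrow> \<exists>m. m \<noteq> 0 \<and> (\<forall>x\<in>V. norm ((L ^^ m) x) \<le> q ^ m * norm x)"
  obtains \<delta> where "0 < \<delta>"
    "\<And>x q. x \<in> V \<Longrightarrow> norm x < \<delta> \<Longrightarrow> \<rho> < q \<Longrightarrow> q < 1
       \<Longrightarrow> \<exists>C. eventually (\<lambda>l. norm ((T ^^ l) x) \<le> C * q ^ l) sequentially"
proof -
  have contr: "\<exists>\<delta>>0. \<exists>K>0. \<forall>x\<in>V. norm x < \<delta> \<longrightarrow> (\<forall>l. norm ((T ^^ l) x) \<le> K * q ^ l * norm x)"
    if q: "\<rho> < q" "q < 1" for q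
  proof -
    define p where "p = (\<rho> + q) / 2"
    have p: "0 < p" "\<rho> < p" "p < q" "p < 1" using q \<rho> by (auto simp: p_def)
    obtain m where m: "m \<noteq> 0" "\<forall>x\<in>V. norm ((L ^^ m) x) \<le> p ^ m * norm x"
      using pow p by blast
    show ?thesis
      using local_contraction_of_linear_part[OF V TV T0 deriv p(1,3) q(2) m(1) m(2)[rule_format]]
      by metis
  qed
  define q0 where "q0 = (\<rho> + 1) / 2"
  have q0: "\<rho> < q0" "q0 < 1" "0 < q0" using \<rho> by (auto simp: q0_def)
  obtain \<delta> K where \<delta>: "0 < \<delta>" "0 < K"
    "\<And>x l. x \<in> V \<Longrightarrow> norm x < \<delta> \<Longrightarrow> norm ((T ^^ l) x) \<le> K * q0 ^ l * norm x"
    using contr[OF q0(1,2)] by metis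
  show thesis
  proof (rule that[OF \<delta>(1)])
    fix x q assume x: "x \<in> V" "norm x < \<delta>" and q: "\<rho> < q" "q < 1"
    obtain \<delta>' K' where \<delta>': "0 < \<delta>'" "0 < K'"
      "\<And>x l. x \<in> V \<Longrightarrow> norm x < \<delta>' \<Longrightarrow> norm ((T ^^ l) x) \<le> K' * q ^ l * norm x"
      using contr[OF q] by metis
    have "(\<lambda>l. K * q0 ^ l * norm x) \<longlonglongrightarrow> K * 0 * norm x"
      using q0 by (intro tendsto_intros LIMSEQ_power_zero) auto
    then have "eventually (\<lambda>l. K * q0 ^ l * norm x < \<delta>') sequentially"
      using \<delta>'(1) by (auto dest: order_tendstoD(2))
    then obtain n where "K * q0 ^ n * norm x < \<delta>'" by (auto simp: eventually_sequentially)
    then have n: "norm ((T ^^ n) x) < \<delta>'" using \<delta>(3)[OF x, of n] by simp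
    have TnV: "(T ^^ n) x \<in> V" by (induction n) (auto simp: x TV)
    have "norm ((T ^^ l) x) \<le> K' * norm ((T ^^ n) x) / q ^ n * q ^ l" if "l \<ge> n" for l
    proof -
      have "(T ^^ l) x = (T ^^ (l - n)) ((T ^^ n) x)"
        using that by (metis comp_apply funpow_add le_add_diff_inverse2)
      then have "norm ((T ^^ l) x) \<le> K' * q ^ (l - n) * norm ((T ^^ n) x)"
        using \<delta>'(3)[OF TnV n] by simp
      also have "\<dots> = K' * norm ((T ^^ n) x) / q ^ n * q ^ l"
        using q \<rho> that by (simp add: power_diff)
      finally show ?thesis .
    qed
    then show "\<exists>C. eventually (\<lambda>l. norm ((T ^^ l) x) \<le> C * q ^ l) sequentially"
      unfolding eventually_sequentially by blast
  qed
qed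

text \<open>Constants disappear under the root because \<open>D powr (1 / real l)\<close> tends to 1
  for positive \<open>D\<close>; then \<open>q\<close> approaches \<open>\<rho>\<close> from
  above.\<close>

lemma limsup_root_le_of_geometric_bounds:
  fixes f :: "nat \<Rightarrow> 'a::real_normed_vector"
  assumes \<rho>: "0 \<le> \<rho>" "\<rho> < 1"
    and geo: "\<And>q. \<rho> < q \<Longrightarrow> q < 1 \<Longrightarrow> \<exists>C. eventually (\<lambda>l. norm (f l) \<le> C * q ^ l) sequentially"
  shows "limsup (\<lambda>l. ereal (norm (f l) powr (1 / real l))) \<le> ereal \<rho>"
proof -
  let ?S = "limsup (\<lambda>l. ereal (norm (f l) powr (1 / real l)))"
  have le: "?S \<le> ereal q" if q: "\<rho> < q" "q < 1" for q
  proof -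
    obtain C where C: "eventually (\<lambda>l. norm (f l) \<le> C * q ^ l) sequentially"
      using geo[OF q] by blast
    define D where "D = max C 1"
    then have D: "0 < D" by simp
    have q0: "0 < q" using q \<rho> by simp
    have "eventually (\<lambda>l. ereal (norm (f l) powr (1 / real l)) \<le> ereal (D powr (1 / real l) * q)) sequentially"
      using C eventually_gt_at_top[of 0]
    proof eventually_elim
      case (elim l)
      have "C * q ^ l \<le> D * q ^ l" using q0 by (intro mult_right_mono) (auto simp: D_def)
      then have "norm (f l) powr (1 / real l) \<le> (D * q ^ l) powr (1 / real l)"
        using elim by (intro powr_mono2) auto
      also have "\<dots> = D powr (1 / real l) * (q powr real l) powr (1 / real l)"
        using q0 by (simp add: powr_mult D_def powr_realpow)
      also have "(q powr real l) powr (1 / real l) = q"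
        using q0 elim by (simp add: powr_powr)
      finally show ?case by simp
    qed
    then have "?S \<le> limsup (\<lambda>l. ereal (D powr (1 / real l) * q))"
      by (rule Limsup_mono)
    also have "\<dots> = ereal q"
    proof (rule lim_imp_Limsup)
      have "(\<lambda>l. D powr (1 / real l) * q) \<longlonglongrightarrow> D powr 0 * q"
        by (intro tendsto_intros lim_1_over_n) (auto simp: D_def)
      then show "(\<lambda>l. ereal (D powr (1 / real l) * q)) \<longlonglongrightarrow> ereal q"
        using D by simp
    qed simp
    finally show ?thesis .
  qed
  show ?thesis
  proof (rule ccontr)
    assume "\<not> ?S \<le> ereal \<rho>"
    \<comment> \<open>The minimum with 1 keeps \<open>q\<close> in the range where \<open>le\<close>
      applies.\<close>
    then have "ereal \<rho> < min ?S 1" using \<rho> by (simp add: one_ereal_def)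
    then obtain q where q: "ereal \<rho> < ereal q" "ereal q < min ?S 1"
      using ereal_dense2 by blast
    then have "\<rho> < q" "q < 1" "ereal q < ?S" by (simp_all add: one_ereal_def)
    with le[of q] show False by (meson leD)
  qed
qed

section \<open>The spectrum of the Markov matrix of a positive coupling\<close>

text \<open>\<open>g\<close> stands for the optimal plan, the fixed point around which the iteration
  is linearized.\<close>

locale positive_coupling =
  fixes \<mu>1 :: "real^'n1" and \<mu>2 :: "real^'n2" and g :: "real^'n2^'n1"
  assumes pos: "\<And>i j. 0 < g $ i $ j"
    and row: "\<And>i. (\<Sum>j\<in>UNIV. g $ i $ j) = \<mu>1 $ i"
    and col: "\<And>j. (\<Sum>i\<in>UNIV. g $ i $ j) = \<mu>2 $ j"
begin

lemma \<mu>1_pos: "0 < \<mu>1 $ i"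
  unfolding row[symmetric] using pos by (intro sum_pos) auto

lemma \<mu>2_pos: "0 < \<mu>2 $ j"
  unfolding col[symmetric] using pos by (intro sum_pos) auto

lemma \<mu>1_neq_0 [simp]: "\<mu>1 $ i \<noteq> 0" and \<mu>2_neq_0 [simp]: "\<mu>2 $ j \<noteq> 0"
  using \<mu>1_pos[of i] \<mu>2_pos[of j] by auto

text \<open>\<open>row_avg\<close> and \<open>col_avg\<close> are the conditional expectations given
  the row and the column index under the weights \<open>g\<close>; they arise as derivatives of
  logarithmic marginals at \<open>g\<close>.\<close>

definition row_avg :: "real^'n2^'n1 \<Rightarrow> real^'n1" where
  "row_avg X = (\<chi> i. (\<Sum>j\<in>UNIV. g $ i $ j * X $ i $ j) / \<mu>1 $ i)"

definition col_avg :: "real^'n2^'n1 \<Rightarrow> real^'n2" where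
  "col_avg X = (\<chi> j. (\<Sum>i\<in>UNIV. g $ i $ j * X $ i $ j) / \<mu>2 $ j)"

definition of_row :: "real^'n1 \<Rightarrow> real^'n2^'n1" where
  "of_row a = (\<chi> i j. a $ i)"

definition of_col :: "real^'n2 \<Rightarrow> real^'n2^'n1" where
  "of_col b = (\<chi> i j. b $ j)"

lemma of_row_nth [simp]: "of_row a $ i $ j = a $ i"
  and of_col_nth [simp]: "of_col b $ i $ j = b $ j"
  by (simp_all add: of_row_def of_col_def)

lemma row_avg_nth: "row_avg X $ i = (\<Sum>j\<in>UNIV. g $ i $ j * X $ i $ j) / \<mu>1 $ i"
  and col_avg_nth: "col_avg X $ j = (\<Sum>i\<in>UNIV. g $ i $ j * X $ i $ j) / \<mu>2 $ j"
  by (simp_all add: row_avg_def col_avg_def)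

lemma linear_row_avg: "linear row_avg" and linear_col_avg: "linear col_avg"
  and linear_of_row: "linear of_row" and linear_of_col: "linear of_col"
  by (auto intro!: linearI simp: vec_eq_iff row_avg_nth col_avg_nth algebra_simps sum.distrib
      sum_distrib_left add_divide_distrib)

lemma row_avg_of_row [simp]: "row_avg (of_row a) = a"
  by (simp add: vec_eq_iff row_avg_nth row flip: sum_distrib_right)

lemma col_avg_of_col [simp]: "col_avg (of_col b) = b"
  by (simp add: vec_eq_iff col_avg_nth col flip: sum_distrib_right)

definition mean :: "real^'n1 \<Rightarrow> real" where
  "mean a = (\<Sum>i\<in>UNIV. \<mu>1 $ i * a $ i)"

lemma mean_row_avg: "mean (row_avg X) = (\<Sum>i\<in>UNIV. \<Sum>j\<in>UNIV. g $ i $ j * X $ i $ j)"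
  by (simp add: mean_def row_avg_nth)

text \<open>Tower property: conditioning on the column index leaves the \<open>g\<close>-weighted
  total unchanged. In particular \<open>M1\<close> preserves \<open>mean\<close>.\<close>

lemma mean_row_avg_of_col_avg: "mean (row_avg (of_col (col_avg X))) = mean (row_avg X)"
proof -
  have "mean (row_avg (of_col (col_avg X))) = (\<Sum>j\<in>UNIV. \<Sum>i\<in>UNIV. g $ i $ j * col_avg X $ j)"
    unfolding mean_row_avg by (subst sum.swap) simp
  also have "\<dots> = (\<Sum>j\<in>UNIV. \<Sum>i\<in>UNIV. g $ i $ j * X $ i $ j)"
    by (simp only: sum_distrib_right[symmetric] col) (simp add: col_avg_nth)
  also have "\<dots> = mean (row_avg X)"
    unfolding mean_row_avg by (rule sum.swap)
  finally show ?thesis .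
qed

lemma linear_mean: "linear mean"
  by (auto intro!: linearI simp: mean_def algebra_simps sum.distrib sum_distrib_left)

lemma M1_nth: "M1 \<mu>1 \<mu>2 g $ i $ k = (\<Sum>j\<in>UNIV. g $ i $ j * g $ k $ j / (\<mu>1 $ i * \<mu>2 $ j))"
proof -
  have "M1 \<mu>1 \<mu>2 g $ i $ k =
    (\<Sum>j\<in>UNIV. (diag_matrix (\<chi> i. 1 / \<mu>1 $ i) ** g ** diag_matrix (\<chi> j. 1 / \<mu>2 $ j)) $ i $ j * g $ k $ j)"
    unfolding M1_def by (subst matrix_matrix_mult_def) (simp add: transpose_def)
  then show ?thesis by (simp add: matrix_mul_diag_matrix diag_matrix_mul_matrix)
qed

lemma M1_eq_averages: "M1 \<mu>1 \<mu>2 g *v a = row_avg (of_col (col_avg (of_row a)))"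
proof -
  have "(M1 \<mu>1 \<mu>2 g *v a) $ i = row_avg (of_col (col_avg (of_row a))) $ i" for i
  proof -
    have "(M1 \<mu>1 \<mu>2 g *v a) $ i =
      (\<Sum>k\<in>UNIV. \<Sum>j\<in>UNIV. g $ i $ j * g $ k $ j / (\<mu>1 $ i * \<mu>2 $ j) * a $ k)"
      by (simp add: matrix_vector_mult_def M1_nth sum_distrib_right)
    also have "\<dots> = (\<Sum>j\<in>UNIV. \<Sum>k\<in>UNIV. g $ i $ j * g $ k $ j / (\<mu>1 $ i * \<mu>2 $ j) * a $ k)"
      by (rule sum.swap)
    also have "\<dots> = row_avg (of_col (col_avg (of_row a))) $ i"
      by (simp add: row_avg_nth col_avg_nth sum_divide_distrib sum_distrib_left mult_ac)
    finally show ?thesis .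
  qed
  then show ?thesis by (simp add: vec_eq_iff)
qed

text \<open>Conjugation by the square roots of \<open>\<mu>1\<close> turns \<open>M1\<close> into
  the symmetric matrix \<open>A\<close>.\<close>

lemma M1_diagonalizable:
  obtains P P' :: "real^'n1^'n1" and s where "P' ** P = mat 1" "P ** P' = mat 1"
    "P ** M1 \<mu>1 \<mu>2 g = diag_matrix s ** P"
proof -
  define M where "M = M1 \<mu>1 \<mu>2 g"
  define A :: "real^'n1^'n1" where "A = (\<chi> i k. sqrt (\<mu>1 $ i) * M $ i $ k / sqrt (\<mu>1 $ k))"
  have A: "A $ i $ k = (\<Sum>j\<in>UNIV. g $ i $ j * g $ k $ j / (sqrt (\<mu>1 $ i) * sqrt (\<mu>1 $ k) * \<mu>2 $ j))" for i k
  proof -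
    have "sqrt (\<mu>1 $ i) * (1 / \<mu>1 $ i) = 1 / sqrt (\<mu>1 $ i)"
      using \<mu>1_pos[of i] by (simp add: field_simps)
    then show ?thesis
      unfolding A_def M_def M1_nth
      using \<mu>1_pos[of i] \<mu>1_pos[of k]
      by (simp add: sum_distrib_left sum_divide_distrib) (intro sum.cong refl, simp add: field_simps)
  qed
  have "transpose A = A"
    by (simp add: vec_eq_iff transpose_def A mult_ac)
  then obtain Q :: "real^'n1^'n1" and d where Q: "transpose Q ** Q = mat 1" "Q ** transpose Q = mat 1"
    "transpose Q ** A = diag_matrix d ** transpose Q"
    using symmetric_matrix_diagonalizable by blast
  define R R' where "R = diag_matrix (\<chi> i. sqrt (\<mu>1 $ i))" and "R' = diag_matrix (\<chi> i. 1 / sqrt (\<mu>1 $ i))"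
  have RR': "R ** R' = mat 1" "R' ** R = mat 1"
    using \<mu>1_pos less_imp_neq[OF \<mu>1_pos]
    by (auto simp: vec_eq_iff R_def R'_def diag_matrix_mul_matrix diag_matrix_nth mat_def)
  have RM: "R ** M = A ** R"
    using less_imp_neq[OF \<mu>1_pos]
    by (auto simp: vec_eq_iff R_def A_def diag_matrix_mul_matrix matrix_mul_diag_matrix)
  define P P' where "P = transpose Q ** R" and "P' = R' ** Q"
  have "P' ** P = R' ** (Q ** transpose Q) ** R"
    by (simp only: P_def P'_def matrix_mul_assoc)
  then have 1: "P' ** P = mat 1" using Q RR' by simp
  have "P ** M = transpose Q ** (R ** M)" by (simp only: P_def matrix_mul_assoc)
  also have "\<dots> = (transpose Q ** A) ** R" by (simp only: RM matrix_mul_assoc)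
  also have "\<dots> = diag_matrix d ** P" by (simp only: Q(3) P_def matrix_mul_assoc)
  finally have "P ** M1 \<mu>1 \<mu>2 g = diag_matrix d ** P" by (simp add: M_def)
  moreover have "P ** P' = mat 1" using 1 by (simp add: matrix_left_right_inverse)
  ultimately show thesis using that[OF 1] by blast
qed

text \<open>The second identity is a Dirichlet form: it expresses \<open>1 - s\<close> through the
  deviation of \<open>v\<close> from its conditional expectation \<open>w\<close>. Both right-hand
  sides are sums of nonnegative terms.\<close>

lemma M1_dirichlet_form:
  assumes "M1 \<mu>1 \<mu>2 g *v v = s *\<^sub>R v"
  defines "w \<equiv> col_avg (of_row v)"
  shows "s * (\<Sum>i\<in>UNIV. \<mu>1 $ i * (v $ i)\<^sup>2) = (\<Sum>j\<in>UNIV. \<mu>2 $ j * (w $ j)\<^sup>2)"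
    and "(1 - s) * (\<Sum>i\<in>UNIV. \<mu>1 $ i * (v $ i)\<^sup>2)
      = (\<Sum>i\<in>UNIV. \<Sum>j\<in>UNIV. g $ i $ j * (v $ i - w $ j)\<^sup>2)"
proof -
  define N where "N = (\<Sum>i\<in>UNIV. \<mu>1 $ i * (v $ i)\<^sup>2)"
  define W where "W = (\<Sum>j\<in>UNIV. \<mu>2 $ j * (w $ j)\<^sup>2)"
  have sv: "s * v $ i = (\<Sum>j\<in>UNIV. g $ i $ j * w $ j) / \<mu>1 $ i" for i
    using arg_cong[OF assms(1), of "\<lambda>x. x $ i"] by (simp add: M1_eq_averages row_avg_nth w_def)
  have \<mu>sv: "\<mu>1 $ i * (s * v $ i) = (\<Sum>j\<in>UNIV. g $ i $ j * w $ j)" for i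
    by (simp add: sv)
  have w: "\<mu>2 $ j * w $ j = (\<Sum>i\<in>UNIV. g $ i $ j * v $ i)" for j
    by (simp add: w_def col_avg_nth)
  have cross: "(\<Sum>i\<in>UNIV. \<Sum>j\<in>UNIV. g $ i $ j * (v $ i * w $ j)) = W"
  proof -
    have "(\<Sum>i\<in>UNIV. \<Sum>j\<in>UNIV. g $ i $ j * (v $ i * w $ j)) = (\<Sum>j\<in>UNIV. w $ j * (\<Sum>i\<in>UNIV. g $ i $ j * v $ i))"
      by (subst sum.swap) (simp add: sum_distrib_left mult_ac)
    also have "\<dots> = W"
      by (simp only: w[symmetric] W_def power2_eq_square) (simp add: mult_ac)
    finally show ?thesis .
  qed
  have "s * N = (\<Sum>i\<in>UNIV. v $ i * (\<mu>1 $ i * (s * v $ i)))"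
    by (simp add: N_def sum_distrib_left power2_eq_square mult_ac)
  also have "\<dots> = (\<Sum>i\<in>UNIV. \<Sum>j\<in>UNIV. g $ i $ j * (v $ i * w $ j))"
    by (simp only: \<mu>sv) (simp add: sum_distrib_left mult_ac)
  finally show sN: "s * N = W" using cross by simp
  have "(\<Sum>i\<in>UNIV. \<Sum>j\<in>UNIV. g $ i $ j * (v $ i - w $ j)\<^sup>2)
    = (\<Sum>i\<in>UNIV. \<Sum>j\<in>UNIV. g $ i $ j * (v $ i)\<^sup>2) + (\<Sum>i\<in>UNIV. \<Sum>j\<in>UNIV. g $ i $ j * (w $ j)\<^sup>2)
      - 2 * (\<Sum>i\<in>UNIV. \<Sum>j\<in>UNIV. g $ i $ j * (v $ i * w $ j))"
    by (simp add: sum_distrib_left sum.distrib[symmetric] sum_subtractf[symmetric] power2_eq_square algebra_simps)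
  also have "(\<Sum>i\<in>UNIV. \<Sum>j\<in>UNIV. g $ i $ j * (v $ i)\<^sup>2) = N"
    by (simp add: N_def row flip: sum_distrib_right)
  also have "(\<Sum>i\<in>UNIV. \<Sum>j\<in>UNIV. g $ i $ j * (w $ j)\<^sup>2) = W"
    by (subst sum.swap) (simp add: W_def col flip: sum_distrib_right)
  finally show "(1 - s) * N = (\<Sum>i\<in>UNIV. \<Sum>j\<in>UNIV. g $ i $ j * (v $ i - w $ j)\<^sup>2)"
    using cross sN by (simp add: algebra_simps)
qed

text \<open>Nonnegativity of the two quadratic forms bounds \<open>s\<close>. At
  \<open>s = 1\<close> the Dirichlet form vanishes, and positivity of every entry of
  \<open>g\<close> makes \<open>v\<close> constant.\<close>

lemma M1_eigenvalue:
  assumes eig: "M1 \<mu>1 \<mu>2 g *v v = s *\<^sub>R v" and v: "v \<noteq> 0"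
  shows "0 \<le> s" "s \<le> 1" "s = 1 \<Longrightarrow> v $ i = v $ k"
proof -
  define N where "N = (\<Sum>i\<in>UNIV. \<mu>1 $ i * (v $ i)\<^sup>2)"
  define w where "w = col_avg (of_row v)"
  note form = M1_dirichlet_form[OF eig, folded N_def w_def]
  obtain i0 where "v $ i0 \<noteq> 0" using v by (auto simp: vec_eq_iff)
  then have N: "0 < N" unfolding N_def
    using \<mu>1_pos less_imp_le[OF \<mu>1_pos] by (intro sum_pos2[of _ i0]) auto
  have nonneg: "0 \<le> g $ i $ j * (v $ i - w $ j)\<^sup>2" for i j using less_imp_le[OF pos] by simp
  have "0 \<le> s * N" unfolding form using less_imp_le[OF \<mu>2_pos] by (intro sum_nonneg) auto
  then show "0 \<le> s" using N by (simp add: zero_le_mult_iff)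
  have "0 \<le> (1 - s) * N" unfolding form using nonneg by (intro sum_nonneg) auto
  then show "s \<le> 1" using N by (simp add: zero_le_mult_iff)
  assume "s = 1"
  then have "(\<Sum>i\<in>UNIV. \<Sum>j\<in>UNIV. g $ i $ j * (v $ i - w $ j)\<^sup>2) = 0" using form(2) by simp
  then have "g $ i $ j * (v $ i - w $ j)\<^sup>2 = 0" for i j
    using nonneg by (simp add: sum_nonneg_eq_0_iff sum_nonneg)
  then have "v $ i = w $ j" for i j
    using pos[of i j] by (metis eq_iff_diff_eq_0 less_irrefl mult_eq_0_iff zero_eq_power2)
  then show "v $ i = v $ k" by metis
qed

lemma M1_const: "M1 \<mu>1 \<mu>2 g *v (\<chi> i. c) = (\<chi> i. c)"
proof -
  have "of_row (\<chi> i. c) = of_col (\<chi> j. c)" by (simp add: vec_eq_iff)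
  moreover have "of_col (\<chi> j. c) = of_row (\<chi> i. c)" by (simp add: vec_eq_iff)
  ultimately show ?thesis by (metis M1_eq_averages row_avg_of_row col_avg_of_col)
qed

text \<open>\<open>i0\<close> marks the simple eigenvalue 1. The other eigenvectors have mean zero,
  so this coordinate is proportional to \<open>mean\<close> and can be treated apart.\<close>

lemma M1_spectrum:
  assumes n: "CARD('n1) \<ge> 2"
  obtains P P' :: "real^'n1^'n1" and s i0 m where
    "P' ** P = mat 1" "P ** M1 \<mu>1 \<mu>2 g = diag_matrix s ** P"
    "\<And>i. i \<noteq> i0 \<Longrightarrow> 0 \<le> s $ i \<and> s $ i \<le> second_largest_eigenvalue (M1 \<mu>1 \<mu>2 g)"
    "\<And>z. (P *v z) $ i0 = m * mean z"
    "0 \<le> second_largest_eigenvalue (M1 \<mu>1 \<mu>2 g)" "second_largest_eigenvalue (M1 \<mu>1 \<mu>2 g) < 1"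
proof -
  let ?M = "M1 \<mu>1 \<mu>2 g"
  obtain P P' :: "real^'n1^'n1" and s where P: "P' ** P = mat 1" "P ** P' = mat 1"
    and PM: "P ** ?M = diag_matrix s ** P"
    using M1_diagonalizable by blast
  define v where "v i = column i P'" for i
  have "?M ** P' = P' ** (P ** ?M) ** P'" using P by (simp add: matrix_mul_assoc)
  also have "\<dots> = P' ** diag_matrix s ** (P ** P')" by (simp only: PM matrix_mul_assoc)
  finally have MP': "?M ** P' = P' ** diag_matrix s" using P by simp
  have v_eig: "?M *v v i = s $ i *\<^sub>R v i" for i
  proof -
    have "(?M *v v i) $ k = (?M ** P') $ k $ i" for k
      by (simp add: v_def column_def matrix_vector_mult_def matrix_matrix_mult_def)
    then show ?thesis by (simp add: vec_eq_iff MP' matrix_mul_diag_matrix v_def column_def mult.commute)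
  qed
  have Pv: "(P *v v i) $ k = (if k = i then 1 else 0)" for i k
  proof -
    have "(P *v v i) $ k = (P ** P') $ k $ i"
      by (simp add: v_def column_def matrix_vector_mult_def matrix_matrix_mult_def)
    then show ?thesis using P by (simp add: mat_def)
  qed
  have v_neq: "v i \<noteq> 0" for i
  proof
    assume "v i = 0"
    with Pv[of i i] show False by simp
  qed
  note ev = M1_eigenvalue[OF v_eig v_neq]
  have expand: "z = (\<Sum>i\<in>UNIV. (P *v z) $ i *\<^sub>R v i)" for z
  proof -
    have "z = P' *v (P *v z)" using P by (simp add: matrix_vector_mul_assoc)
    also have "\<dots> = (\<Sum>i\<in>UNIV. (P *v z) $ i *\<^sub>R v i)"
      by (simp add: matrix_mult_sum v_def scalar_mult_eq_scaleR)
    finally show ?thesis .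
  qed
  \<comment> \<open>The all-ones vector is fixed by \<open>M1\<close>, so any index at which its
    coordinate is nonzero carries the eigenvalue 1.\<close>
  define u :: "real^'n1" where "u = (\<chi> i. 1)"
  have "P *v u = P *v (?M *v u)" by (simp add: u_def M1_const)
  also have "\<dots> = diag_matrix s *v (P *v u)"
    by (simp add: matrix_vector_mul_assoc PM)
  finally have Pu: "(P *v u) $ i = s $ i * (P *v u) $ i" for i
    by (metis diag_matrix_mul_vec)
  have "\<exists>i. (P *v u) $ i \<noteq> 0"
  proof (rule ccontr)
    assume "\<not> ?thesis"
    then have "u = 0" by (subst expand) simp
    then show False by (simp add: u_def vec_eq_iff)
  qed
  then obtain i0 where i0: "s $ i0 = 1" using Pu by (metis mult_cancel_right1)
  \<comment> \<open>A second eigenvalue 1 would make two columns of \<open>P'\<close> constant,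
    hence proportional, against invertibility.\<close>
  have lt: "s $ i < 1" if i: "i \<noteq> i0" for i
  proof (rule ccontr)
    assume "\<not> s $ i < 1"
    then have "s $ i = 1" using ev(2)[of i] by simp
    then have const: "v i = v i $ i *\<^sub>R u" "v i0 = v i0 $ i *\<^sub>R u"
      using ev(3)[of i] ev(3)[of i0] i0 unfolding vec_eq_iff u_def by auto
    have "(P *v v i) $ i0 = v i $ i * (P *v u) $ i0" 
      by (subst const) (simp add: matrix_vector_mult_scaleR)
    then have "v i $ i = 0 \<or> (P *v u) $ i0 = 0" using Pv[of i i0] i by simp
    moreover have "(P *v v i0) $ i0 = v i0 $ i * (P *v u) $ i0"
      by (subst const) (simp add: matrix_vector_mult_scaleR)
    ultimately have "v i $ i = 0" using Pv[of i0 i0] by auto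
    then show False using v_neq[of i] const(1) by simp
  qed
  let ?l = "second_largest_eigenvalue ?M"
  have roots: "proots (charpoly ?M) = image_mset (($) s) (mset_set UNIV)"
    using proots_charpoly_diagonalizable[OF P(1) PM] .
  have le: "s $ i \<le> s $ i0" for i using ev(2) i0 by simp
  obtain i1 where i1: "i1 \<noteq> i0" "s $ i1 = ?l"
    using second_largest_eigenvalue_characterization(1)[OF roots n le] by blast
  \<comment> \<open>\<open>M1\<close> preserves the mean, yet multiplies that of \<open>v i\<close>
    by \<open>s $ i\<close>, which is not 1.\<close>
  have mean_v: "mean (v i) = 0" if "i \<noteq> i0" for i
  proof -
    have "s $ i * mean (v i) = mean (?M *v v i)"
      by (simp add: v_eig linear_cmul[OF linear_mean])
    also have "\<dots> = mean (v i)"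
      by (simp add: M1_eq_averages mean_row_avg_of_col_avg)
    finally show ?thesis using lt[OF that] by simp
  qed
  have mean_eq: "mean z = (P *v z) $ i0 * mean (v i0)" for z
  proof -
    have "mean z = (\<Sum>i\<in>UNIV. (P *v z) $ i * mean (v i))"
      by (subst expand) (simp add: linear_sum[OF linear_mean] linear_cmul[OF linear_mean])
    also have "\<dots> = (\<Sum>i\<in>{i0}. (P *v z) $ i * mean (v i))"
      using mean_v by (intro sum.mono_neutral_right) auto
    finally show ?thesis by simp
  qed
  have "mean u > 0" unfolding mean_def u_def using \<mu>1_pos by (auto intro!: sum_pos)
  then have "mean (v i0) \<noteq> 0" using mean_eq[of u] by auto
  then have coord: "(P *v z) $ i0 = (1 / mean (v i0)) * mean z" for z
    using mean_eq[of z] by simp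
  show thesis
  proof (rule that[OF P(1) PM _ coord])
    show "0 \<le> s $ i \<and> s $ i \<le> ?l" if "i \<noteq> i0" for i
      using ev(1) second_largest_eigenvalue_characterization(2)[OF roots n le that] by simp
    show "0 \<le> ?l" using ev(1)[of i1] i1 by simp
    show "?l < 1" using lt[OF i1(1)] i1 by simp
  qed
qed

lemma spectral_gap_bounds:
  assumes "CARD('n1) \<ge> 2" and "1 - \<eta> = second_largest_eigenvalue (M1 \<mu>1 \<mu>2 g)"
  shows "0 < \<eta>" "\<eta> \<le> 1"
proof -
  have "0 \<le> 1 - \<eta>" "1 - \<eta> < 1"
    using M1_spectrum[OF assms(1)] unfolding assms(2) by metis+
  then show "0 < \<eta>" "\<eta> \<le> 1" by auto
qed

end

section \<open>The linearized iteration\<close>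

context positive_coupling
begin

definition relaxed_row :: "real \<Rightarrow> real^'n2^'n1 \<Rightarrow> real^'n2^'n1" where
  "relaxed_row \<theta> X = X - \<theta> *\<^sub>R of_row (row_avg X)"

definition relaxed_col :: "real \<Rightarrow> real^'n2^'n1 \<Rightarrow> real^'n2^'n1" where
  "relaxed_col \<theta> X = X - \<theta> *\<^sub>R of_col (col_avg X)"

text \<open>Derivative at \<open>0\<close> of the iteration written in the coordinates \<open>ln (\<gamma> / \<gamma>s)\<close>.\<close>

definition linear_step :: "real \<Rightarrow> real^'n2^'n1 \<Rightarrow> real^'n2^'n1" where
  "linear_step \<theta> X = relaxed_col \<theta> (relaxed_row \<theta> X)"

text \<open>The tangent space, and in logarithmic coordinates the image, of the set of diagonal scalings.\<close>

definition separable :: "(real^'n2^'n1) set" where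
  "separable = {of_row a + of_col b | a b. True}"

lemmas row_avg_simps = linear_add[OF linear_row_avg] linear_diff[OF linear_row_avg] linear_cmul[OF linear_row_avg]
lemmas col_avg_simps = linear_add[OF linear_col_avg] linear_diff[OF linear_col_avg] linear_cmul[OF linear_col_avg]
lemmas of_row_simps = linear_add[OF linear_of_row] linear_diff[OF linear_of_row] linear_cmul[OF linear_of_row]
lemmas of_col_simps = linear_add[OF linear_of_col] linear_diff[OF linear_of_col] linear_cmul[OF linear_of_col]

lemma linear_linear_step: "linear (linear_step \<theta>)"
  by (rule linearI)
    (simp_all add: linear_step_def relaxed_row_def relaxed_col_def row_avg_simps col_avg_simps
      of_row_simps of_col_simps algebra_simps)

lemma subspace_separable: "subspace separable"
proof (rule subspaceI)
  show "0 \<in> separable"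
    unfolding separable_def by (auto intro!: exI[of _ 0] simp: vec_eq_iff)
  fix X Y c assume "X \<in> separable"
  then obtain a b where X: "X = of_row a + of_col b" by (auto simp: separable_def)
  have "c *\<^sub>R X = of_row (c *\<^sub>R a) + of_col (c *\<^sub>R b)"
    by (simp add: X of_row_simps of_col_simps scaleR_add_right)
  then show "c *\<^sub>R X \<in> separable" unfolding separable_def by blast
  assume "Y \<in> separable"
  then obtain a' b' where Y: "Y = of_row a' + of_col b'" by (auto simp: separable_def)
  have "X + Y = of_row (a + a') + of_col (b + b')"
    by (simp add: X Y of_row_simps of_col_simps)
  then show "X + Y \<in> separable" unfolding separable_def by blast
qed

lemma of_row_separable: "of_row a \<in> separable" and of_col_separable: "of_col b \<in> separable"
proof -
  have "of_row a = of_row a + of_col 0" "of_col b = of_row 0 + of_col b" by (simp_all add: vec_eq_iff)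
  then show "of_row a \<in> separable" "of_col b \<in> separable" unfolding separable_def by blast+
qed

lemma linear_step_separable: "X \<in> separable \<Longrightarrow> linear_step \<theta> X \<in> separable"
  unfolding linear_step_def relaxed_row_def relaxed_col_def
  by (intro subspace_diff subspace_scale subspace_separable of_row_separable of_col_separable)

text \<open>A separable matrix with vanishing row and column averages is \<open>g\<close>-orthogonal
  to itself, hence 0; injectivity on a finite-dimensional subspace gives the bound. Iterates are
  thus controlled by their averages.\<close>

lemma separable_norm_bound:
  obtains K where "0 < K" "\<And>X. X \<in> separable \<Longrightarrow> norm X \<le> K * (norm (row_avg X) + norm (col_avg X))"
proof -
  define f where "f X = (row_avg X, col_avg X)" for X
  have lin: "linear f"
    by (rule linearI) (simp_all add: f_def row_avg_simps col_avg_simps)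
  have inj: "X = 0" if X: "X \<in> separable" "f X = 0" for X
  proof -
    obtain a b where ab: "X = of_row a + of_col b" using X(1) by (auto simp: separable_def)
    have "row_avg X $ i = 0" "col_avg X $ j = 0" for i j using X(2) by (simp_all add: f_def zero_prod_def)
    then have rX: "(\<Sum>j\<in>UNIV. g $ i $ j * X $ i $ j) = 0" and cX: "(\<Sum>i\<in>UNIV. g $ i $ j * X $ i $ j) = 0" for i j
      by (simp_all add: row_avg_nth col_avg_nth)
    have "(\<Sum>i\<in>UNIV. \<Sum>j\<in>UNIV. g $ i $ j * (X $ i $ j)\<^sup>2)
      = (\<Sum>i\<in>UNIV. \<Sum>j\<in>UNIV. a $ i * (g $ i $ j * X $ i $ j)) + (\<Sum>i\<in>UNIV. \<Sum>j\<in>UNIV. b $ j * (g $ i $ j * X $ i $ j))"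
      by (simp add: sum.distrib[symmetric] ab power2_eq_square algebra_simps)
    also have "(\<Sum>i\<in>UNIV. \<Sum>j\<in>UNIV. a $ i * (g $ i $ j * X $ i $ j)) = 0"
      by (simp only: sum_distrib_left[symmetric] rX) simp
    also have "(\<Sum>i\<in>UNIV. \<Sum>j\<in>UNIV. b $ j * (g $ i $ j * X $ i $ j)) = 0"
      by (subst sum.swap) (simp only: sum_distrib_left[symmetric] cX, simp)
    finally have "(\<Sum>i\<in>UNIV. \<Sum>j\<in>UNIV. g $ i $ j * (X $ i $ j)\<^sup>2) = 0" by simp
    then have gX: "g $ i $ j * (X $ i $ j)\<^sup>2 = 0" for i j
      using less_imp_le[OF pos] by (simp add: sum_nonneg_eq_0_iff sum_nonneg)
    have "X $ i $ j = 0" for i j using gX[of i j] pos[of i j] by auto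
    then show ?thesis by (simp add: vec_eq_iff)
  qed
  have "closed separable" using subspace_separable by (rule closed_subspace)
  then obtain e where e: "0 < e" "\<forall>X\<in>separable. e * norm X \<le> norm (f X)"
    using injective_imp_isometric[OF _ subspace_separable, of f] lin inj linear_linear
    by (auto simp: mult.commute)
  show thesis
  proof (rule that[of "1 / e"])
    show "0 < 1 / e" using e by simp
    fix X assume "X \<in> separable"
    then have "e * norm X \<le> norm (row_avg X) + norm (col_avg X)"
      using e(2) norm_Pair_le[of "row_avg X" "col_avg X"] unfolding f_def by (meson order_trans)
    then show "norm X \<le> 1 / e * (norm (row_avg X) + norm (col_avg X))"
      using e(1) by (simp add: field_simps)
  qed
qed

section \<open>Row and column averages along the linear iteration\<close>

context
  fixes \<theta> :: real and X :: "real^'n2^'n1"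
begin

definition row_iterate :: "nat \<Rightarrow> real^'n1" where
  "row_iterate k = row_avg ((linear_step \<theta> ^^ k) X)"

text \<open>Taken after the row half-step, since this is the matrix whose column averages the column
  relaxation subtracts.\<close>

definition col_iterate :: "nat \<Rightarrow> real^'n2" where
  "col_iterate k = col_avg (relaxed_row \<theta> ((linear_step \<theta> ^^ k) X))"

lemma row_iterate_Suc:
  "row_iterate (Suc k) = (1 - \<theta>) *\<^sub>R row_iterate k - \<theta> *\<^sub>R row_avg (of_col (col_iterate k))"
  by (simp add: row_iterate_def col_iterate_def linear_step_def relaxed_col_def relaxed_row_def
      row_avg_simps algebra_simps)

lemma col_iterate_Suc:
  "col_iterate (Suc k) = (1 - \<theta>) *\<^sub>R col_iterate k - \<theta> *\<^sub>R col_avg (of_row (row_iterate (Suc k)))"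
proof -
  define Y where "Y = relaxed_row \<theta> ((linear_step \<theta> ^^ k) X)"
  have "(linear_step \<theta> ^^ Suc k) X = relaxed_col \<theta> Y" by (simp add: linear_step_def Y_def)
  then show ?thesis
    by (simp add: col_iterate_def row_iterate_def Y_def[symmetric] relaxed_row_def[of _ "relaxed_col \<theta> Y"]
        col_avg_simps algebra_simps del: funpow.simps) (simp add: relaxed_col_def col_avg_simps algebra_simps)
qed

lemma col_avg_iterate:
  "col_avg ((linear_step \<theta> ^^ k) X) = col_iterate k + \<theta> *\<^sub>R col_avg (of_row (row_iterate k))"
  by (simp add: col_iterate_def row_iterate_def relaxed_row_def col_avg_simps)

text \<open>The column averages are eliminated: \<open>row_iterate_Suc\<close> at \<open>k\<close>
  is solved for their row average, which is inserted at \<open>Suc k\<close>. The two successive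
  averagings combine to \<open>M1\<close>.\<close>

lemma row_iterate_recurrence:
  "row_iterate (Suc (Suc k)) = (2 * (1 - \<theta>)) *\<^sub>R row_iterate (Suc k)
    + \<theta>\<^sup>2 *\<^sub>R (M1 \<mu>1 \<mu>2 g *v row_iterate (Suc k)) - (1 - \<theta>)\<^sup>2 *\<^sub>R row_iterate k"
proof -
  define z where "z = row_iterate"
  define a where "a = row_avg (of_col (col_iterate k))"
  have 1: "\<theta> *\<^sub>R a = (1 - \<theta>) *\<^sub>R z k - z (Suc k)"
    by (simp add: row_iterate_Suc z_def a_def)
  have 2: "row_avg (of_col (col_iterate (Suc k))) = (1 - \<theta>) *\<^sub>R a - \<theta> *\<^sub>R (M1 \<mu>1 \<mu>2 g *v z (Suc k))"
    by (simp add: col_iterate_Suc of_col_simps row_avg_simps M1_eq_averages a_def z_def)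
  have "z (Suc (Suc k)) = (1 - \<theta>) *\<^sub>R z (Suc k)
      - ((1 - \<theta>) *\<^sub>R (\<theta> *\<^sub>R a) - \<theta>\<^sup>2 *\<^sub>R (M1 \<mu>1 \<mu>2 g *v z (Suc k)))"
    unfolding z_def row_iterate_Suc[of "Suc k"] 2 [unfolded z_def]
    by (simp add: scaleR_diff_right power2_eq_square mult.commute)
  then show ?thesis
    unfolding 1 z_def[symmetric]
    by (simp add: vec_eq_iff power2_eq_square algebra_simps)
qed

text \<open>The eigenvalue \<open>1\<close> of \<open>M1\<close> is excluded from the recurrence estimate; its component is the mean,
  which evolves explicitly.\<close>

lemma mean_row_iterate: "mean (row_iterate k) = ((1 - \<theta>)\<^sup>2) ^ k * mean (row_iterate 0)"
proof (induction k)
  case (Suc k)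
  define Y where "Y = relaxed_row \<theta> ((linear_step \<theta> ^^ k) X)"
  have "row_avg Y = (1 - \<theta>) *\<^sub>R row_iterate k"
    by (simp add: Y_def relaxed_row_def row_iterate_def row_avg_simps algebra_simps)
  then have Y: "mean (row_avg Y) = (1 - \<theta>) * mean (row_iterate k)"
    by (simp add: linear_cmul[OF linear_mean])
  have "row_iterate (Suc k) = row_avg Y - \<theta> *\<^sub>R row_avg (of_col (col_avg Y))"
    by (simp add: row_iterate_def linear_step_def relaxed_col_def Y_def[symmetric] row_avg_simps)
  from arg_cong[OF this, of mean] have "mean (row_iterate (Suc k)) = (1 - \<theta>) * mean (row_avg Y)"
    by (simp add: linear_diff[OF linear_mean] linear_cmul[OF linear_mean] mean_row_avg_of_col_avg algebra_simps)
  then show ?case using Suc Y by (simp add: power2_eq_square mult_ac)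
qed simp

end

text \<open>In an eigenbasis of \<open>M1\<close> the recurrence splits into scalar ones. The last
  hypothesis says that the characteristic quadratic at the second largest eigenvalue is nonnegative
  at \<open>r\<close>; by monotonicity this covers all smaller eigenvalues.\<close>

lemma row_iterate_bound:
  assumes n: "CARD('n1) \<ge> 2"
    and r: "0 < r" "r \<le> 1" "\<bar>1 - \<theta>\<bar> \<le> r"
      "\<theta>\<^sup>2 * second_largest_eigenvalue (M1 \<mu>1 \<mu>2 g) * r \<le> (r + \<theta> - 1)\<^sup>2"
  obtains C where "0 \<le> C" "\<And>X k. norm (row_iterate \<theta> X k) \<le> C * (1 + real k) * r ^ k * norm X"
proof -
  obtain P P' :: "real^'n1^'n1" and s i0 m where P: "P' ** P = mat 1"
    and PM: "P ** M1 \<mu>1 \<mu>2 g = diag_matrix s ** P"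
    and s: "\<And>i. i \<noteq> i0 \<Longrightarrow> 0 \<le> s $ i \<and> s $ i \<le> second_largest_eigenvalue (M1 \<mu>1 \<mu>2 g)"
    and coord: "\<And>z. (P *v z) $ i0 = m * mean z"
    using M1_spectrum[OF n] by metis
  have PM_vec: "P *v (M1 \<mu>1 \<mu>2 g *v z) = diag_matrix s *v (P *v z)" for z
    by (simp add: matrix_vector_mul_assoc PM)
  define x where "x i X k = (P *v row_iterate \<theta> X k) $ i" for i X k
  have sq: "(1 - \<theta>)\<^sup>2 \<le> r\<^sup>2" using power_mono[OF r(3) abs_ge_zero, of 2] by (simp only: power2_abs)
  have x_bound: "\<bar>x i X k\<bar> \<le> r ^ k * (\<bar>x i X 0\<bar> + real k * (\<bar>x i X 0\<bar> + \<bar>x i X 1\<bar> / r))" for i X k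
  proof (cases "i = i0")
    \<comment> \<open>On the mean component the factor \<open>(1 - \<theta>)\<^sup>2\<close> is at
      most \<open>r\<^sup>2\<close>, hence at most \<open>r\<close>; the bound is then weakened to
      the common form.\<close>
    case True
    have "\<bar>x i X k\<bar> = ((1 - \<theta>)\<^sup>2) ^ k * \<bar>x i X 0\<bar>"
      by (simp add: True x_def coord mean_row_iterate[of \<theta> X k] abs_mult)
    also have "\<dots> \<le> (r\<^sup>2) ^ k * \<bar>x i X 0\<bar>" 
      by (intro mult_right_mono power_mono[OF sq]) auto
    also have "\<dots> \<le> r ^ k * \<bar>x i X 0\<bar>"
      using r by (intro mult_right_mono power_mono) (auto simp: power2_eq_square mult_left_le)
    also have "\<dots> \<le> r ^ k * (\<bar>x i X 0\<bar> + real k * (\<bar>x i X 0\<bar> + \<bar>x i X 1\<bar> / r))"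
      using r by (intro mult_left_mono) auto
    finally show ?thesis .
  next
    case False
    define \<alpha> where "\<alpha> = 2 * (1 - \<theta>) + \<theta>\<^sup>2 * s $ i"
    have "x i X (Suc (Suc k)) = \<alpha> * x i X (Suc k) - (1 - \<theta>)\<^sup>2 * x i X k" for k
      unfolding x_def row_iterate_recurrence
      by (simp add: matrix_vector_mult_diff_distrib matrix_vector_right_distrib matrix_vector_mult_scaleR
          PM_vec diag_matrix_mul_vec \<alpha>_def algebra_simps)
    moreover have "\<bar>\<alpha>\<bar> * r \<le> r\<^sup>2 + (1 - \<theta>)\<^sup>2"
    proof -
      have "\<theta>\<^sup>2 * s $ i * r \<le> \<theta>\<^sup>2 * second_largest_eigenvalue (M1 \<mu>1 \<mu>2 g) * r"
        using s[OF False] r by (intro mult_right_mono mult_left_mono) auto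
      also have "\<dots> \<le> (r + \<theta> - 1)\<^sup>2" by (rule r(4))
      finally have "\<alpha> * r \<le> r\<^sup>2 + (1 - \<theta>)\<^sup>2"
        by (simp add: \<alpha>_def power2_eq_square algebra_simps)
      moreover have "- \<alpha> * r \<le> r\<^sup>2 + (1 - \<theta>)\<^sup>2"
      proof -
        have "0 \<le> \<theta>\<^sup>2 * s $ i * r" using s[OF False] r by simp
        moreover have "0 \<le> (r + (1 - \<theta>))\<^sup>2" by simp
        ultimately show ?thesis by (simp add: \<alpha>_def power2_eq_square algebra_simps)
      qed
      ultimately show ?thesis by (auto simp: abs_if)
    qed
    ultimately show ?thesis
      using second_order_recurrence_bound[of "x i X" \<alpha> "(1 - \<theta>)\<^sup>2" r k] r sq by simp
  qed
  \<comment> \<open>The initial values depend linearly on \<open>X\<close>, which makes the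
    constants uniform in \<open>X\<close>.\<close>
  have "linear (\<lambda>X. P *v row_iterate \<theta> X 0)" "linear (\<lambda>X. P *v row_iterate \<theta> X 1)"
    by (rule linearI; simp add: row_iterate_def row_avg_simps linear_add[OF linear_linear_step]
        linear_cmul[OF linear_linear_step] matrix_vector_right_distrib matrix_vector_mult_scaleR)+
  then obtain B0 B1 where B: "0 < B0" "\<And>X. norm (P *v row_iterate \<theta> X 0) \<le> B0 * norm X"
      "0 < B1" "\<And>X. norm (P *v row_iterate \<theta> X 1) \<le> B1 * norm X"
    using linear_bounded_pos by metis
  obtain B' where B': "0 < B'" "\<And>x. norm (P' *v x) \<le> B' * norm x"
    using linear_bounded_pos[OF matrix_vector_mul_linear[of P']] by metis
  define D where "D = 2 * B0 + B1 / r"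
  have D: "0 \<le> D" using B r by (simp add: D_def)
  have x_le: "\<bar>x i X k\<bar> \<le> (1 + real k) * r ^ k * (D * norm X)" for i X k
  proof -
    have 0: "\<bar>x i X 0\<bar> \<le> B0 * norm X"
      unfolding x_def using component_le_norm_cart B(2) by (rule order_trans)
    have 1: "\<bar>x i X 1\<bar> / r \<le> B1 * norm X / r"
      unfolding x_def using r by (intro divide_right_mono order_trans[OF component_le_norm_cart B(4)]) auto
    have "\<bar>x i X 0\<bar> + real k * (\<bar>x i X 0\<bar> + \<bar>x i X 1\<bar> / r) \<le> B0 * norm X + real k * (B0 * norm X + B1 * norm X / r)"
      using 0 1 by (intro add_mono mult_left_mono) auto
    also have "\<dots> \<le> D * norm X + real k * (D * norm X)"
      using B r by (intro add_mono mult_left_mono) (auto simp: D_def algebra_simps)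
    also have "\<dots> = (1 + real k) * (D * norm X)" by (simp add: algebra_simps)
    finally have "r ^ k * (\<bar>x i X 0\<bar> + real k * (\<bar>x i X 0\<bar> + \<bar>x i X 1\<bar> / r)) \<le> r ^ k * ((1 + real k) * (D * norm X))"
      using r by (intro mult_left_mono) auto
    then show ?thesis using x_bound[of i X k] by (simp add: mult_ac)
  qed
  show thesis
  proof (rule that[of "B' * real CARD('n1) * D"])
    show "0 \<le> B' * real CARD('n1) * D" using B' D by simp
    fix X k
    have "norm (row_iterate \<theta> X k) = norm (P' *v (P *v row_iterate \<theta> X k))"
      by (simp add: matrix_vector_mul_assoc P)
    also have "\<dots> \<le> B' * norm (P *v row_iterate \<theta> X k)" by (rule B')
    also have "\<dots> \<le> B' * (\<Sum>i\<in>UNIV. \<bar>x i X k\<bar>)"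
      unfolding x_def using B' by (intro mult_left_mono norm_le_l1_cart) auto
    also have "\<dots> \<le> B' * (\<Sum>i\<in>(UNIV :: 'n1 set). (1 + real k) * r ^ k * (D * norm X))"
      using B' x_le by (intro mult_left_mono sum_mono) auto
    finally show "norm (row_iterate \<theta> X k) \<le> B' * real CARD('n1) * D * (1 + real k) * r ^ k * norm X"
      by (simp add: mult_ac)
  qed
qed

text \<open>Column averages solve a first-order recurrence with factor \<open>1 - \<theta>\<close>,
  driven by the row averages. Factor and forcing may both be of size \<open>r\<close>, and this
  resonance costs one further power of \<open>1 + real k\<close>.\<close>

lemma linear_step_power_bound:
  assumes n: "CARD('n1) \<ge> 2"
    and r: "0 < r" "r \<le> 1" "\<bar>1 - \<theta>\<bar> \<le> r"
      "\<theta>\<^sup>2 * second_largest_eigenvalue (M1 \<mu>1 \<mu>2 g) * r \<le> (r + \<theta> - 1)\<^sup>2"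
  obtains C where "0 \<le> C"
    "\<And>X k. X \<in> separable \<Longrightarrow> norm ((linear_step \<theta> ^^ k) X) \<le> C * (1 + real k)\<^sup>2 * r ^ k * norm X"
proof -
  obtain C where C: "0 \<le> C" "\<And>X k. norm (row_iterate \<theta> X k) \<le> C * (1 + real k) * r ^ k * norm X"
    using row_iterate_bound[OF n r] by metis
  obtain D where D: "0 < D" "\<And>a. norm (col_avg (of_row a)) \<le> D * norm a"
    using linear_bounded_pos[OF linear_compose[OF linear_of_row linear_col_avg]] by (auto simp: o_def)
  have "linear (\<lambda>X. col_iterate \<theta> X 0)"
    by (rule linearI) (simp_all add: col_iterate_def relaxed_row_def row_avg_simps col_avg_simps of_row_simps algebra_simps)
  then obtain B where B: "0 < B" "\<And>X. norm (col_iterate \<theta> X 0) \<le> B * norm X"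
    using linear_bounded_pos by metis
  define G where "G = B + \<bar>\<theta>\<bar> * D * C"
  have G: "0 \<le> G" "B \<le> G" "\<bar>\<theta>\<bar> * D * C \<le> G" using B C D by (auto simp: G_def)
  have avg_le: "norm (\<theta> *\<^sub>R col_avg (of_row (row_iterate \<theta> X k))) \<le> G * (1 + real k) * r ^ k * norm X" for X k
  proof -
    have "norm (\<theta> *\<^sub>R col_avg (of_row (row_iterate \<theta> X k))) \<le> \<bar>\<theta>\<bar> * (D * (C * (1 + real k) * r ^ k * norm X))"
      unfolding norm_scaleR using D C
      by (intro mult_left_mono order_trans[OF D(2)]) auto
    also have "\<dots> = (\<bar>\<theta>\<bar> * D * C) * ((1 + real k) * r ^ k * norm X)" by (simp add: mult_ac)
    also have "\<dots> \<le> G * ((1 + real k) * r ^ k * norm X)"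
      using G r by (intro mult_right_mono) auto
    finally show ?thesis by (simp add: mult_ac)
  qed
  have col_le: "norm (col_iterate \<theta> X k) \<le> G * (1 + real k)\<^sup>2 * r ^ k * norm X" for X k
  proof (induction k)
    case 0
    then show ?case using order_trans[OF B(2) mult_right_mono[OF G(2) norm_ge_zero]] by simp
  next
    case (Suc k)
    have "norm (col_iterate \<theta> X (Suc k)) \<le> \<bar>1 - \<theta>\<bar> * norm (col_iterate \<theta> X k)
        + norm (\<theta> *\<^sub>R col_avg (of_row (row_iterate \<theta> X (Suc k))))"
      unfolding col_iterate_Suc by (rule order_trans[OF norm_triangle_ineq4]) simp
    also have "\<dots> \<le> r * (G * (1 + real k)\<^sup>2 * r ^ k * norm X) + G * (1 + real (Suc k)) * r ^ Suc k * norm X"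
      by (intro add_mono mult_mono avg_le Suc.IH) (use r in auto)
    also have "\<dots> = ((1 + real k)\<^sup>2 + (1 + real (Suc k))) * (G * r ^ Suc k * norm X)"
      by (simp add: algebra_simps)
    \<comment> \<open>Amounts to
      \<open>(1 + k)\<^sup>2 + (2 + k) \<le> (2 + k)\<^sup>2\<close>.\<close>
    also have "\<dots> \<le> (1 + real (Suc k))\<^sup>2 * (G * r ^ Suc k * norm X)"
      using G r by (intro mult_right_mono) (auto simp: power2_eq_square algebra_simps)
    finally show ?case by (simp add: mult_ac)
  qed
  obtain K where K: "0 < K" "\<And>X. X \<in> separable \<Longrightarrow> norm X \<le> K * (norm (row_avg X) + norm (col_avg X))"
    using separable_norm_bound by metis
  show thesis
  proof (rule that[of "K * (C + 2 * G)"])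
    show "0 \<le> K * (C + 2 * G)" using K C G by simp
    fix X k assume "X \<in> separable"
    then have "(linear_step \<theta> ^^ k) X \<in> separable"
      by (induction k) (auto simp: linear_step_separable)
    from K(2)[OF this] have "norm ((linear_step \<theta> ^^ k) X) \<le> K * (norm (row_iterate \<theta> X k)
        + norm (col_iterate \<theta> X k + \<theta> *\<^sub>R col_avg (of_row (row_iterate \<theta> X k))))"
      by (simp only: col_avg_iterate row_iterate_def)
    also have "\<dots> \<le> K * (C * (1 + real k) * r ^ k * norm X
        + (G * (1 + real k)\<^sup>2 * r ^ k * norm X + G * (1 + real k) * r ^ k * norm X))"
      using K(1) by (intro mult_left_mono add_mono C(2) order_trans[OF norm_triangle_ineq] col_le avg_le) auto
    also have "\<dots> = K * ((C + G) * (1 + real k) + G * (1 + real k)\<^sup>2) * (r ^ k * norm X)"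
      by (simp add: algebra_simps)
    also have "\<dots> \<le> K * ((C + G) * (1 + real k)\<^sup>2 + G * (1 + real k)\<^sup>2) * (r ^ k * norm X)"
      using K(1) C(1) G(1) r
      by (intro mult_right_mono mult_left_mono add_mono) (auto simp: power2_eq_square)
    also have "\<dots> = K * (C + 2 * G) * (1 + real k)\<^sup>2 * r ^ k * norm X"
      by (simp add: algebra_simps)
    finally show "norm ((linear_step \<theta> ^^ k) X) \<le> K * (C + 2 * G) * (1 + real k)\<^sup>2 * r ^ k * norm X" .
  qed
qed

text \<open>With \<open>r\<close> strictly between \<open>rate \<theta> \<eta>\<close> and
  \<open>q\<close>, the polynomial factor is absorbed by the powers of \<open>r / q\<close>.\<close>

lemma linear_step_contracts:
  assumes n: "CARD('n1) \<ge> 2" and \<eta>: "1 - \<eta> = second_largest_eigenvalue (M1 \<mu>1 \<mu>2 g)"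
    and \<theta>: "0 < \<theta>" "\<theta> < 2" and q: "rate \<theta> \<eta> < q" "q < 1"
  shows "\<exists>m. m \<noteq> 0 \<and> (\<forall>X\<in>separable. norm ((linear_step \<theta> ^^ m) X) \<le> q ^ m * norm X)"
proof -
  note \<eta>01 = spectral_gap_bounds[OF n \<eta>]
  define r where "r = (rate \<theta> \<eta> + q) / 2"
  have "\<bar>1 - \<theta>\<bar> \<le> rate \<theta> \<eta>" using rate_ge[OF \<eta>01 \<theta>] .
  then have r: "0 < r" "r \<le> 1" "\<bar>1 - \<theta>\<bar> \<le> r" "rate \<theta> \<eta> < r" "r < q" using q by (auto simp: r_def)
  have "\<theta>\<^sup>2 * second_largest_eigenvalue (M1 \<mu>1 \<mu>2 g) * r \<le> (r + \<theta> - 1)\<^sup>2"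
    using rate_less_imp[OF \<eta>01 \<theta> r(4)] \<eta> by simp
  then obtain C where C: "0 \<le> C"
    "\<And>X k. X \<in> separable \<Longrightarrow> norm ((linear_step \<theta> ^^ k) X) \<le> C * (1 + real k)\<^sup>2 * r ^ k * norm X"
    using linear_step_power_bound[OF n r(1-3)] by metis
  define p where "p = r / q"
  have p: "0 < p" "p < 1" using r q by (auto simp: p_def)
  have "(\<lambda>k. C * (1 + real k)\<^sup>2 * p ^ k) \<longlonglongrightarrow> 0" using p by real_asymp
  then have "eventually (\<lambda>k. C * (1 + real k)\<^sup>2 * p ^ k < 1) sequentially"
    by (rule order_tendstoD) simp
  then have "eventually (\<lambda>k. C * (1 + real k)\<^sup>2 * p ^ k < 1 \<and> k > 0) sequentially"
    using eventually_gt_at_top by (rule eventually_conj)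
  then obtain m where m: "C * (1 + real m)\<^sup>2 * p ^ m < 1" "m > 0"
    by (auto simp: eventually_sequentially)
  have "C * (1 + real m)\<^sup>2 * r ^ m \<le> q ^ m"
    using m(1) r by (simp add: p_def power_divide field_simps)
  then have "norm ((linear_step \<theta> ^^ m) X) \<le> q ^ m * norm X" if "X \<in> separable" for X
    using order_trans[OF C(2)[OF that, of m] mult_right_mono[OF _ norm_ge_zero]] by blast
  then show ?thesis using m(2) by blast
qed

end

section \<open>The entropic minimizer\<close>

text \<open>Tangent inequality for the convex function \<open>x * (ln x - 1)\<close>, whose
  derivative is \<open>ln x\<close>; it follows from \<open>ln z \<le> z - 1\<close> at
  \<open>z = x / y\<close>, with the boundary point \<open>y = 0\<close> checked directly.\<close>

lemma entropy_tangent: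
  fixes x y :: real
  assumes "0 < x" "0 \<le> y"
  shows "x * (ln x - 1) + ln x * (y - x) \<le> y * (ln y - 1)"
proof (cases "y = 0")
  case False
  then have y: "0 < y" using assms by simp
  have "y * ln (x / y) \<le> y * (x / y - 1)"
    using assms y by (intro mult_left_mono ln_le_minus_one) auto
  then show ?thesis using assms y by (simp add: ln_div algebra_simps)
qed (use assms in \<open>simp add: algebra_simps\<close>)

text \<open>Two tangent inequalities at the positive point \<open>m\<close> are averaged; the slope
  terms cancel because \<open>m\<close> is the weighted mean of \<open>a\<close> and
  \<open>b\<close>.\<close>

lemma entropy_convex:
  fixes a b t :: real
  assumes "0 \<le> a" "0 < b" "0 < t" "t \<le> 1"
  defines "m \<equiv> (1 - t) * a + t * b"
  shows "m * (ln m - 1) \<le> (1 - t) * (a * (ln a - 1)) + t * (b * (ln b - 1))"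
proof -
  have m: "0 < m" unfolding m_def using assms by (intro add_nonneg_pos mult_nonneg_nonneg) auto
  have "(1 - t) * (m * (ln m - 1) + ln m * (a - m)) + t * (m * (ln m - 1) + ln m * (b - m))
    \<le> (1 - t) * (a * (ln a - 1)) + t * (b * (ln b - 1))"
    using assms m by (intro add_mono mult_left_mono entropy_tangent) auto
  moreover have "(1 - t) * (m * (ln m - 1) + ln m * (a - m)) + t * (m * (ln m - 1) + ln m * (b - m))
    = m * (ln m - 1) + ln m * (((1 - t) * a + t * b) - m)"
    by (simp add: algebra_simps)
  ultimately show ?thesis by (simp add: m_def)
qed

definition entry_cost :: "real^'n2^'n1 \<Rightarrow> real \<Rightarrow> 'n1 \<Rightarrow> 'n2 \<Rightarrow> real \<Rightarrow> real" where
  "entry_cost c \<epsilon> i j x = c $ i $ j * x + \<epsilon> * (x * (ln x - 1))"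

lemma entropic_cost_eq:
  fixes c \<gamma> :: "real^'n2^'n1"
  shows "entropic_cost c \<epsilon> \<gamma> = (\<Sum>i\<in>UNIV. \<Sum>j\<in>UNIV. entry_cost c \<epsilon> i j (\<gamma> $ i $ j))
    + \<epsilon> * (\<Sum>i\<in>(UNIV :: 'n1 set). \<Sum>j\<in>(UNIV :: 'n2 set). 1)"
  by (simp add: entropic_cost_def KL_def entry_cost_def sum.distrib sum_distrib_left distrib_left)

lemma transport_plans_iff:
  "\<gamma> \<in> transport_plans \<mu>1 \<mu>2 \<longleftrightarrow> (\<forall>i. (\<Sum>j\<in>UNIV. \<gamma> $ i $ j) = \<mu>1 $ i)
    \<and> (\<forall>j. (\<Sum>i\<in>UNIV. \<gamma> $ i $ j) = \<mu>2 $ j) \<and> (\<forall>i j. 0 \<le> \<gamma> $ i $ j)"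
  by (auto simp: transport_plans_def row_constraint_def col_constraint_def row_marginal_def
      col_marginal_def vec_eq_iff)

context
  fixes \<mu>1 :: "real^'n1" and \<mu>2 :: "real^'n2" and c \<gamma> :: "real^'n2^'n1" and \<epsilon> :: real
  assumes \<mu>: "discrete_probability \<mu>1" "discrete_probability \<mu>2" and \<epsilon>: "0 < \<epsilon>"
    and min: "is_arg_min (entropic_cost c \<epsilon>) (\<lambda>\<gamma>. \<gamma> \<in> transport_plans \<mu>1 \<mu>2) \<gamma>"
begin

lemma minimizer_marginals:
  "(\<Sum>j\<in>UNIV. \<gamma> $ i $ j) = \<mu>1 $ i" "(\<Sum>i\<in>UNIV. \<gamma> $ i $ j) = \<mu>2 $ j" "0 \<le> \<gamma> $ i $ j"
  using min by (auto simp: is_arg_min_def transport_plans_iff)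

lemma minimizer_le:
  assumes "\<pi> \<in> transport_plans \<mu>1 \<mu>2"
  shows "(\<Sum>i\<in>UNIV. \<Sum>j\<in>UNIV. entry_cost c \<epsilon> i j (\<gamma> $ i $ j))
    \<le> (\<Sum>i\<in>UNIV. \<Sum>j\<in>UNIV. entry_cost c \<epsilon> i j (\<pi> $ i $ j))"
  using min assms by (auto simp: is_arg_min_def entropic_cost_eq not_less)

text \<open>At a vanishing entry the entropy has slope \<open>-\<infinity>\<close>, so moving towards the product plan
  would decrease the cost.\<close>

lemma minimizer_positive: "0 < \<gamma> $ i0 $ j0"
proof (rule ccontr)
  assume "\<not> 0 < \<gamma> $ i0 $ j0"
  then have zero: "\<gamma> $ i0 $ j0 = 0" using minimizer_marginals(3)[of i0 j0] by simp
  define H where "H \<pi> = (\<Sum>i\<in>UNIV. \<Sum>j\<in>UNIV. entry_cost c \<epsilon> i j (\<pi> $ i $ j))" for \<pi> :: "real^'n2^'n1"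
  define \<pi> :: "real^'n2^'n1" where "\<pi> = (\<chi> i j. \<mu>1 $ i * \<mu>2 $ j)"
  have \<pi>: "0 < \<pi> $ i $ j" for i j using \<mu> by (simp add: \<pi>_def discrete_probability_def)
  have \<pi>_sum: "(\<Sum>j\<in>UNIV. \<pi> $ i $ j) = \<mu>1 $ i" "(\<Sum>i\<in>UNIV. \<pi> $ i $ j) = \<mu>2 $ j" for i j
    using \<mu> by (simp_all add: \<pi>_def discrete_probability_def flip: sum_distrib_left sum_distrib_right)
  define p where "p = \<epsilon> * \<pi> $ i0 $ j0"
  have p: "0 < p" using \<epsilon> \<pi> by (simp add: p_def)
  \<comment> \<open>Chosen so that \<open>p * ln t\<close> outweighs the difference between
    \<open>H \<pi>\<close> and \<open>H \<gamma>\<close>.\<close>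
  define t where "t = exp (- (\<bar>H \<pi> - H \<gamma>\<bar> + 1) / p)"
  have t: "0 < t" "t \<le> 1" using p by (auto simp: t_def divide_le_0_iff)
  define \<zeta> :: "real^'n2^'n1" where "\<zeta> = (\<chi> i j. (1 - t) * \<gamma> $ i $ j + t * \<pi> $ i $ j)"
  have "\<zeta> \<in> transport_plans \<mu>1 \<mu>2"
    using minimizer_marginals \<pi>_sum less_imp_le[OF \<pi>] t
    by (simp add: transport_plans_iff \<zeta>_def sum.distrib flip: sum_distrib_left) (simp add: algebra_simps)
  have delta: "(\<Sum>j\<in>UNIV. if i = i0 then if j = j0 then K else 0 else 0) = (if i = i0 then K else 0)"
    for i and K :: real
    by (cases "i = i0") simp_all
  have "H \<gamma> \<le> H \<zeta>" using \<open>\<zeta> \<in> transport_plans \<mu>1 \<mu>2\<close> minimizer_le by (simp add: H_def)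
  also have "H \<zeta> \<le> (\<Sum>i\<in>UNIV. \<Sum>j\<in>UNIV. (1 - t) * entry_cost c \<epsilon> i j (\<gamma> $ i $ j)
      + t * entry_cost c \<epsilon> i j (\<pi> $ i $ j) + (if i = i0 then if j = j0 then p * t * ln t else 0 else 0))"
    unfolding H_def
  proof (intro sum_mono)
    fix i j
    show "entry_cost c \<epsilon> i j (\<zeta> $ i $ j) \<le> (1 - t) * entry_cost c \<epsilon> i j (\<gamma> $ i $ j)
      + t * entry_cost c \<epsilon> i j (\<pi> $ i $ j) + (if i = i0 then if j = j0 then p * t * ln t else 0 else 0)"
    proof (cases "i = i0 \<and> j = j0")
      \<comment> \<open>Here the mixture is \<open>t\<close> times the entry of
        \<open>\<pi>\<close>, and its logarithm produces the extra term
        \<open>p * t * ln t\<close>.\<close>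
      case True
      then show ?thesis
        using t \<pi>[of i j] zero by (simp add: entry_cost_def \<zeta>_def p_def ln_mult algebra_simps)
    next
      case False
      let ?a = "\<gamma> $ i $ j" and ?b = "\<pi> $ i $ j"
      have "\<epsilon> * (\<zeta> $ i $ j * (ln (\<zeta> $ i $ j) - 1))
          \<le> \<epsilon> * ((1 - t) * (?a * (ln ?a - 1)) + t * (?b * (ln ?b - 1)))"
        unfolding \<zeta>_def using entropy_convex[OF minimizer_marginals(3) \<pi> t] \<epsilon>
        by (intro mult_left_mono) auto
      then have "entry_cost c \<epsilon> i j (\<zeta> $ i $ j) \<le> c $ i $ j * ((1 - t) * ?a + t * ?b)
          + \<epsilon> * ((1 - t) * (?a * (ln ?a - 1)) + t * (?b * (ln ?b - 1)))"
        by (simp add: entry_cost_def) (simp add: \<zeta>_def)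
      also have "\<dots> = (1 - t) * entry_cost c \<epsilon> i j ?a + t * entry_cost c \<epsilon> i j ?b"
        unfolding entry_cost_def by algebra
      finally show ?thesis using False by auto
    qed
  qed
  also have "\<dots> = (1 - t) * H \<gamma> + t * H \<pi> + p * t * ln t"
    by (simp add: H_def sum.distrib sum_distrib_left delta)
  finally have "0 \<le> t * (H \<pi> - H \<gamma> + p * ln t)" by (simp add: algebra_simps)
  then have "0 \<le> H \<pi> - H \<gamma> + p * ln t" using t by (simp add: zero_le_mult_iff)
  moreover have "p * ln t = - (\<bar>H \<pi> - H \<gamma>\<bar> + 1)" using p by (simp add: t_def)
  ultimately show False by simp
qed

text \<open>First-order optimality along the mass exchanges \<open>(e i - e i') (e j - e j')\<^sup>T\<close>, which preserve both
  marginals, says that \<open>k\<close> is a sum of a row and a column function.\<close>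

lemma minimizer_exchange:
  defines "k \<equiv> \<chi> i j. c $ i $ j + \<epsilon> * ln (\<gamma> $ i $ j)"
  shows "k $ i $ j - k $ i $ j' = k $ i' $ j - k $ i' $ j'"
proof -
  define u where "u = (axis i 1 - axis i' 1 :: real^'n1)"
  define v where "v = (axis j 1 - axis j' 1 :: real^'n2)"
  define F where "F t = (\<Sum>a\<in>UNIV. \<Sum>b\<in>UNIV. entry_cost c \<epsilon> a b (\<gamma> $ a $ b + t * (u $ a * v $ b)))" for t
  have "((\<lambda>t. entry_cost c \<epsilon> a b (\<gamma> $ a $ b + t * (u $ a * v $ b)))
      has_real_derivative u $ a * v $ b * k $ a $ b) (at 0)" for a b
    using minimizer_positive[of a b] unfolding entry_cost_def k_def
    by (auto intro!: derivative_eq_intros simp: algebra_simps)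
  then have deriv: "(F has_real_derivative (\<Sum>a\<in>UNIV. \<Sum>b\<in>UNIV. u $ a * v $ b * k $ a $ b)) (at 0)"
    unfolding F_def by (intro DERIV_sum)
  \<comment> \<open>Entries of the direction are at most 1 in absolute value, so steps shorter than
    the least entry of \<open>\<gamma>\<close> keep the plan nonnegative for either sign of
    \<open>t\<close>, and 0 is a two-sided local minimum of \<open>F\<close>.\<close>
  define d where "d = Min (range (\<lambda>(a, b). \<gamma> $ a $ b))"
  have d: "0 < d" "\<And>a b. d \<le> \<gamma> $ a $ b"
    unfolding d_def using minimizer_positive by (auto intro!: Min_le)
  have uv: "(\<Sum>a\<in>UNIV. u $ a) = 0" "(\<Sum>b\<in>UNIV. v $ b) = 0"
    by (simp_all add: u_def v_def sum_subtractf axis_def)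
  have uv_le: "\<bar>u $ a * v $ b\<bar> \<le> 1" for a b
    by (simp add: u_def v_def axis_def)
  have F_min: "F 0 \<le> F t" if t: "\<bar>0 - t\<bar> < d" for t
  proof -
    define \<zeta> :: "real^'n2^'n1" where "\<zeta> = (\<chi> a b. \<gamma> $ a $ b + t * (u $ a * v $ b))"
    have "0 \<le> \<zeta> $ a $ b" for a b
    proof -
      have "\<bar>t * (u $ a * v $ b)\<bar> \<le> d * 1"
        unfolding abs_mult[of t] using t uv_le[of a b] by (intro mult_mono) auto
      then show ?thesis using d(2)[of a b] by (simp add: \<zeta>_def abs_le_iff)
    qed
    moreover have "(\<Sum>b\<in>UNIV. \<zeta> $ a $ b) = \<mu>1 $ a" for a
      by (simp add: \<zeta>_def sum.distrib minimizer_marginals uv flip: sum_distrib_left)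
    moreover have "(\<Sum>a\<in>UNIV. \<zeta> $ a $ b) = \<mu>2 $ b" for b
      by (simp add: \<zeta>_def sum.distrib minimizer_marginals uv flip: sum_distrib_left sum_distrib_right)
    ultimately have "\<zeta> \<in> transport_plans \<mu>1 \<mu>2" by (simp add: transport_plans_iff)
    then show ?thesis using minimizer_le[of \<zeta>] by (simp add: F_def \<zeta>_def)
  qed
  have "(\<Sum>a\<in>UNIV. \<Sum>b\<in>UNIV. u $ a * v $ b * k $ a $ b) = 0"
    using DERIV_local_min[OF deriv d(1)] F_min by blast
  moreover have "(\<Sum>a\<in>UNIV. \<Sum>b\<in>UNIV. u $ a * v $ b * k $ a $ b) = u \<bullet> (k *v v)"
    by (simp add: inner_vec_def matrix_vector_mult_def sum_distrib_left mult_ac)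
  moreover have "u \<bullet> (k *v v) = (k $ i $ j - k $ i $ j') - (k $ i' $ j - k $ i' $ j')"
    by (simp add: u_def v_def inner_diff_left matrix_vector_mult_diff_distrib inner_axis inner_commute[of "axis _ _"]
        matrix_vector_mult_basis column_def)
  ultimately show ?thesis by simp
qed

text \<open>The exchange identity splits \<open>k\<close> into a row part and a column part;
  exponentiating \<open>k / \<epsilon>\<close> turns them into the two scaling vectors.\<close>

lemma minimizer_in_diagonal_scalings: "\<gamma> \<in> diagonal_scalings c \<epsilon>"
proof -
  define k where "k = (\<chi> i j. c $ i $ j + \<epsilon> * ln (\<gamma> $ i $ j))"
  fix i0 :: 'n1 and j0 :: 'n2
  define u where "u = (\<chi> i. exp (k $ i $ j0 / \<epsilon>))"
  \<comment> \<open>Subtracting the reference entry \<open>k $ i0 $ j0\<close> keeps it from being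
    counted in both \<open>u\<close> and \<open>v\<close>.\<close>
  define v where "v = (\<chi> j. exp ((k $ i0 $ j - k $ i0 $ j0) / \<epsilon>))"
  have "\<gamma> $ i $ j = u $ i * exp (- c $ i $ j / \<epsilon>) * v $ j" for i j
  proof -
    have "k $ i $ j = k $ i $ j0 + (k $ i0 $ j - k $ i0 $ j0)"
      using minimizer_exchange[of i j j0 i0] by (simp add: k_def)
    moreover have "ln (\<gamma> $ i $ j) = k $ i $ j / \<epsilon> + - c $ i $ j / \<epsilon>"
      using \<epsilon> by (simp add: k_def add_divide_distrib)
    ultimately have "ln (\<gamma> $ i $ j) = k $ i $ j0 / \<epsilon> + - c $ i $ j / \<epsilon> + (k $ i0 $ j - k $ i0 $ j0) / \<epsilon>"
      by (simp add: add_divide_distrib diff_divide_distrib)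
    then have "exp (ln (\<gamma> $ i $ j)) = u $ i * exp (- c $ i $ j / \<epsilon>) * v $ j"
      by (simp only: exp_add u_def v_def vec_lambda_beta)
    then show ?thesis using minimizer_positive[of i j] by simp
  qed
  then have "\<gamma> = diag_matrix u ** map_matrix (\<lambda>x. exp (- x / \<epsilon>)) c ** diag_matrix v"
    by (simp add: vec_eq_iff matrix_mul_diag_matrix diag_matrix_mul_matrix)
  moreover have "0 < u $ i" "0 < v $ j" for i j by (simp_all add: u_def v_def)
  ultimately show ?thesis unfolding diagonal_scalings_def by blast
qed

end

section \<open>The nonlinear iteration in logarithmic coordinates\<close>

lemma has_derivative_vec_componentwise:
  fixes f :: "'a::real_normed_vector \<Rightarrow> 'b::euclidean_space^'n"
  assumes "\<And>i. ((\<lambda>x. f x $ i) has_derivative (\<lambda>h. f' h $ i)) (at x)"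
  shows "(f has_derivative f') (at x)"
proof (subst has_derivative_componentwise_within, intro ballI)
  fix b :: "'b^'n" assume "b \<in> Basis"
  then obtain i u where b: "b = axis i u" by (auto simp: Basis_vec_def)
  show "((\<lambda>x. f x \<bullet> b) has_derivative (\<lambda>h. f' h \<bullet> b)) (at x)"
    unfolding b inner_axis by (intro has_derivative_inner_left assms)
qed

lemma norm_matrix_le_sum:
  fixes A :: "real^'m^'n"
  shows "norm A \<le> (\<Sum>i\<in>UNIV. \<Sum>j\<in>UNIV. \<bar>A $ i $ j\<bar>)"
proof -
  have "norm A \<le> (\<Sum>i\<in>UNIV. norm (A $ i))"
    unfolding norm_vec_def by (intro L2_set_le_sum) auto
  also have "\<dots> \<le> (\<Sum>i\<in>UNIV. \<Sum>j\<in>UNIV. \<bar>A $ i $ j\<bar>)"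
    by (intro sum_mono norm_le_l1_cart)
  finally show ?thesis .
qed

lemma abs_exp_minus_1_le:
  fixes x :: real
  assumes "\<bar>x\<bar> \<le> 1"
  shows "\<bar>exp x - 1\<bar> \<le> 2 * \<bar>x\<bar>"
proof (cases "0 \<le> x")
  case True
  then have "exp x \<le> 1 + x + x\<^sup>2" using assms by (intro exp_bound) auto
  moreover have "x\<^sup>2 \<le> x" using True assms by (simp add: power2_eq_square mult_left_le)
  ultimately show ?thesis using True by simp
next
  case False
  then have "exp x < 1" by simp
  then show ?thesis using exp_ge_add_one_self[of x] False by linarith
qed

context positive_coupling
begin

text \<open>The relaxed row projection, conjugated by \<open>exp_scaling\<close> to logarithmic
  coordinates.\<close>

definition log_row_step :: "real \<Rightarrow> real^'n2^'n1 \<Rightarrow> real^'n2^'n1" where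
  "log_row_step \<theta> X = X - \<theta> *\<^sub>R of_row (\<chi> i. ln ((\<Sum>j\<in>UNIV. g $ i $ j * exp (X $ i $ j)) / \<mu>1 $ i))"

definition log_col_step :: "real \<Rightarrow> real^'n2^'n1 \<Rightarrow> real^'n2^'n1" where
  "log_col_step \<theta> X = X - \<theta> *\<^sub>R of_col (\<chi> j. ln ((\<Sum>i\<in>UNIV. g $ i $ j * exp (X $ i $ j)) / \<mu>2 $ j))"

definition log_step :: "real \<Rightarrow> real^'n2^'n1 \<Rightarrow> real^'n2^'n1" where
  "log_step \<theta> X = log_col_step \<theta> (log_row_step \<theta> X)"

definition exp_scaling :: "real^'n2^'n1 \<Rightarrow> real^'n2^'n1" where
  "exp_scaling X = (\<chi> i j. g $ i $ j * exp (X $ i $ j))"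

definition log_ratio :: "real^'n2^'n1 \<Rightarrow> real^'n2^'n1" where
  "log_ratio y = (\<chi> i j. ln (y $ i $ j / g $ i $ j))"

lemma g_neq_0 [simp]: "g $ i $ j \<noteq> 0"
  using pos[of i j] by simp

text \<open>In logarithms the projection shifts a row by \<open>- ln (R / \<mu>1 $ i)\<close>, where
  \<open>R\<close> is its positive marginal, and relaxation multiplies the shift by
  \<open>\<theta>\<close>.\<close>

lemma relaxed_row_projection_exp_scaling:
  "relaxed \<theta> (row_projection \<mu>1) (exp_scaling X) = exp_scaling (log_row_step \<theta> X)"
proof -
  have "exp ((1 - \<theta>) * ln (g $ i $ j * exp (X $ i $ j)) + \<theta> * ln (\<mu>1 $ i / R * (g $ i $ j * exp (X $ i $ j))))
    = g $ i $ j * exp (X $ i $ j - \<theta> * ln (R / \<mu>1 $ i))" if "0 < R" for R i j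
  proof -
    have "(1 - \<theta>) * ln (g $ i $ j * exp (X $ i $ j)) + \<theta> * ln (\<mu>1 $ i / R * (g $ i $ j * exp (X $ i $ j)))
      = ln (g $ i $ j) + (X $ i $ j - \<theta> * ln (R / \<mu>1 $ i))"
      using that \<mu>1_pos[of i] pos[of i j] by (simp add: ln_mult ln_div algebra_simps)
    then show ?thesis using pos[of i j] by (simp add: exp_add)
  qed
  moreover have "0 < (\<Sum>j\<in>UNIV. g $ i $ j * exp (X $ i $ j))" for i
    using pos by (intro sum_pos) auto
  ultimately show ?thesis
    by (simp add: vec_eq_iff relaxed_def row_projection_def row_marginal_def exp_scaling_def log_row_step_def)
qed

lemma relaxed_col_projection_exp_scaling:
  "relaxed \<theta> (col_projection \<mu>2) (exp_scaling X) = exp_scaling (log_col_step \<theta> X)"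
proof -
  have "exp ((1 - \<theta>) * ln (g $ i $ j * exp (X $ i $ j)) + \<theta> * ln (g $ i $ j * exp (X $ i $ j) * (\<mu>2 $ j / R)))
    = g $ i $ j * exp (X $ i $ j - \<theta> * ln (R / \<mu>2 $ j))" if "0 < R" for R i j
  proof -
    have "(1 - \<theta>) * ln (g $ i $ j * exp (X $ i $ j)) + \<theta> * ln (g $ i $ j * exp (X $ i $ j) * (\<mu>2 $ j / R))
      = ln (g $ i $ j) + (X $ i $ j - \<theta> * ln (R / \<mu>2 $ j))"
      using that \<mu>2_pos[of j] pos[of i j] by (simp add: ln_mult ln_div algebra_simps)
    then show ?thesis using pos[of i j] by (simp add: exp_add)
  qed
  moreover have "0 < (\<Sum>i\<in>UNIV. g $ i $ j * exp (X $ i $ j))" for j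
    using pos by (intro sum_pos) auto
  ultimately show ?thesis
    by (simp add: vec_eq_iff relaxed_def col_projection_def col_marginal_def exp_scaling_def log_col_step_def)
qed

lemma overrelaxed_step_exp_scaling:
  "overrelaxed_step \<mu>1 \<mu>2 \<theta> (exp_scaling X) = exp_scaling (log_step \<theta> X)"
  by (simp add: overrelaxed_step_def log_step_def relaxed_row_projection_exp_scaling
      relaxed_col_projection_exp_scaling)

lemma overrelaxed_iterate_exp_scaling:
  "(overrelaxed_step \<mu>1 \<mu>2 \<theta> ^^ l) (exp_scaling X) = exp_scaling ((log_step \<theta> ^^ l) X)"
  by (induction l) (simp_all add: overrelaxed_step_exp_scaling)

lemma log_step_separable: "X \<in> separable \<Longrightarrow> log_step \<theta> X \<in> separable"
  unfolding log_step_def log_row_step_def log_col_step_def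
  by (intro subspace_diff subspace_scale subspace_separable of_row_separable of_col_separable)

lemma log_row_step_0: "log_row_step \<theta> 0 = 0" and log_col_step_0: "log_col_step \<theta> 0 = 0"
  by (simp_all add: vec_eq_iff log_row_step_def log_col_step_def row col)

lemma has_derivative_entry:
  "((\<lambda>X :: real^'n2^'n1. X $ i $ j) has_derivative (\<lambda>H. H $ i $ j)) (at X)"
  by (intro bounded_linear_imp_has_derivative bounded_linear_compose[OF bounded_linear_vec_nth bounded_linear_vec_nth, simplified o_def])

text \<open>At 0 the argument of the logarithm is 1, by the row marginals of \<open>g\<close>, so
  its derivative is the weighted average \<open>row_avg\<close>.\<close>

lemma log_row_step_derivative: "(log_row_step \<theta> has_derivative relaxed_row \<theta>) (at 0)"
proof -
  have "((\<lambda>X. (\<chi> i. ln ((\<Sum>j\<in>UNIV. g $ i $ j * exp (X $ i $ j)) / \<mu>1 $ i))) has_derivative row_avg) (at 0)"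
  proof (rule has_derivative_vec_componentwise)
    fix i
    show "((\<lambda>X. (\<chi> i. ln ((\<Sum>j\<in>UNIV. g $ i $ j * exp (X $ i $ j)) / \<mu>1 $ i)) $ i)
        has_derivative (\<lambda>H. row_avg H $ i)) (at 0)"
      using \<mu>1_pos[of i]
      by (auto intro!: derivative_eq_intros has_derivative_entry simp: row row_avg_nth mult.commute)
  qed
  then show ?thesis
    unfolding log_row_step_def[abs_def] relaxed_row_def[abs_def]
    by (intro has_derivative_diff has_derivative_ident has_derivative_scaleR_right
        bounded_linear.has_derivative[OF linear_conv_bounded_linear[THEN iffD1, OF linear_of_row]])
qed

lemma log_col_step_derivative: "(log_col_step \<theta> has_derivative relaxed_col \<theta>) (at 0)"
proof -
  have "((\<lambda>X. (\<chi> j. ln ((\<Sum>i\<in>UNIV. g $ i $ j * exp (X $ i $ j)) / \<mu>2 $ j))) has_derivative col_avg) (at 0)"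
  proof (rule has_derivative_vec_componentwise)
    fix j
    show "((\<lambda>X. (\<chi> j. ln ((\<Sum>i\<in>UNIV. g $ i $ j * exp (X $ i $ j)) / \<mu>2 $ j)) $ j)
        has_derivative (\<lambda>H. col_avg H $ j)) (at 0)"
      using \<mu>2_pos[of j]
      by (auto intro!: derivative_eq_intros has_derivative_entry simp: col col_avg_nth mult.commute)
  qed
  then show ?thesis
    unfolding log_col_step_def[abs_def] relaxed_col_def[abs_def]
    by (intro has_derivative_diff has_derivative_ident has_derivative_scaleR_right
        bounded_linear.has_derivative[OF linear_conv_bounded_linear[THEN iffD1, OF linear_of_col]])
qed

lemma log_step_derivative: "(log_step \<theta> has_derivative linear_step \<theta>) (at 0)"
  unfolding log_step_def[abs_def] linear_step_def[abs_def]
  by (intro has_derivative_compose[OF log_row_step_derivative])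
    (simp add: log_row_step_0 log_col_step_derivative)

text \<open>The exponential is Lipschitz near 0; this carries geometric bounds from logarithmic
  coordinates back to plans.\<close>

lemma norm_exp_scaling_minus_le:
  obtains B where "0 \<le> B" "\<And>X. norm X \<le> 1 \<Longrightarrow> norm (exp_scaling X - g) \<le> B * norm X"
proof (rule that[of "\<Sum>i\<in>UNIV. \<Sum>j\<in>UNIV. 2 * g $ i $ j"])
  show "0 \<le> (\<Sum>i\<in>UNIV. \<Sum>j\<in>UNIV. 2 * g $ i $ j)"
    using less_imp_le[OF pos] by (intro sum_nonneg) auto
  fix X :: "real^'n2^'n1" assume X: "norm X \<le> 1"
  have entry: "\<bar>X $ i $ j\<bar> \<le> norm X" for i j
    using component_le_norm_cart[of "X $ i" j] Finite_Cartesian_Product.norm_nth_le[of X i] by linarith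
  have "norm (exp_scaling X - g) \<le> (\<Sum>i\<in>UNIV. \<Sum>j\<in>UNIV. \<bar>(exp_scaling X - g) $ i $ j\<bar>)"
    by (rule norm_matrix_le_sum)
  also have "\<dots> \<le> (\<Sum>i\<in>UNIV. \<Sum>j\<in>UNIV. 2 * g $ i $ j * norm X)"
  proof (intro sum_mono)
    fix i j
    have "(exp_scaling X - g) $ i $ j = g $ i $ j * (exp (X $ i $ j) - 1)"
      by (simp add: exp_scaling_def algebra_simps)
    then have "\<bar>(exp_scaling X - g) $ i $ j\<bar> = g $ i $ j * \<bar>exp (X $ i $ j) - 1\<bar>"
      using pos[of i j] by (simp add: abs_mult)
    also have "\<dots> \<le> g $ i $ j * (2 * norm X)"
      using order_trans[OF abs_exp_minus_1_le mult_left_mono[OF entry]] entry[of i j] X pos[of i j]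
      by (intro mult_left_mono) (auto intro: order_trans)
    finally show "\<bar>(exp_scaling X - g) $ i $ j\<bar> \<le> 2 * g $ i $ j * norm X" by (simp add: mult_ac)
  qed
  finally show "norm (exp_scaling X - g) \<le> (\<Sum>i\<in>UNIV. \<Sum>j\<in>UNIV. 2 * g $ i $ j) * norm X"
    by (simp add: sum_distrib_right)
qed

text \<open>The common kernel cancels in the quotient of two diagonal scalings, so its logarithm is
  a row function plus a column function.\<close>

lemma diagonal_scalings_log_ratio:
  assumes g: "g \<in> diagonal_scalings c \<epsilon>" and y: "y \<in> diagonal_scalings c \<epsilon>"
  shows "log_ratio y \<in> separable" "exp_scaling (log_ratio y) = y" "0 < y $ i $ j"
proof -
  obtain u v where uv: "\<And>i. 0 < u $ i" "\<And>j. 0 < v $ j"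
    and g_eq: "\<And>i j. g $ i $ j = u $ i * exp (- c $ i $ j / \<epsilon>) * v $ j"
    using g by (force simp: diagonal_scalings_def matrix_mul_diag_matrix diag_matrix_mul_matrix)
  obtain u' v' where uv': "\<And>i. 0 < u' $ i" "\<And>j. 0 < v' $ j"
    and y_eq: "\<And>i j. y $ i $ j = u' $ i * exp (- c $ i $ j / \<epsilon>) * v' $ j"
    using y by (force simp: diagonal_scalings_def matrix_mul_diag_matrix diag_matrix_mul_matrix)
  show y_pos: "0 < y $ i $ j" for i j by (simp add: y_eq uv')
  then show "exp_scaling (log_ratio y) = y"
    using pos by (simp add: vec_eq_iff exp_scaling_def log_ratio_def)
  have "ln (y $ i $ j / g $ i $ j) = ln (u' $ i / u $ i) + ln (v' $ j / v $ j)" for i j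
  proof -
    have "y $ i $ j / g $ i $ j = (u' $ i / u $ i) * (v' $ j / v $ j)" by (simp add: y_eq g_eq)
    then show ?thesis using uv uv' by (simp only: ln_mult_pos divide_pos_pos)
  qed
  then have "log_ratio y = of_row (\<chi> i. ln (u' $ i / u $ i)) + of_col (\<chi> j. ln (v' $ j / v $ j))"
    by (simp add: vec_eq_iff log_ratio_def)
  then show "log_ratio y \<in> separable" unfolding separable_def by blast
qed

text \<open>The iteration is conjugate to \<open>log_step\<close> on \<open>separable\<close>, and
  powers of its linearization contract at every rate above \<open>rate \<theta> \<eta>\<close>. The
  estimate is carried back through \<open>exp_scaling\<close>.\<close>

theorem overrelaxed_converges_locally:
  assumes n: "CARD('n1) \<ge> 2" and \<eta>: "1 - \<eta> = second_largest_eigenvalue (M1 \<mu>1 \<mu>2 g)"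
    and \<theta>: "0 < \<theta>" "\<theta> < 2" and g: "g \<in> diagonal_scalings c \<epsilon>"
  shows "converges_locally_at_rate (overrelaxed_step \<mu>1 \<mu>2 \<theta>) (diagonal_scalings c \<epsilon>) g (rate \<theta> \<eta>)"
proof -
  define S where "S = diagonal_scalings c \<epsilon>"
  define \<rho> where "\<rho> = rate \<theta> \<eta>"
  note \<eta>01 = spectral_gap_bounds[OF n \<eta>]
  have \<rho>: "0 \<le> \<rho>" "\<rho> < 1"
    using rate_ge[OF \<eta>01 \<theta>] rate_less_1[OF \<eta>01 \<theta>] by (auto simp: \<rho>_def)
  have step0: "log_step \<theta> 0 = 0" by (simp add: log_step_def log_row_step_0 log_col_step_0)
  have "\<exists>m. m \<noteq> 0 \<and> (\<forall>X\<in>separable. norm ((linear_step \<theta> ^^ m) X) \<le> q ^ m * norm X)"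
    if "\<rho> < q" "q < 1" for q
    using linear_step_contracts[OF n \<eta> \<theta>] that by (simp add: \<rho>_def)
  then obtain \<delta> where \<delta>: "0 < \<delta>"
    "\<And>X q. X \<in> separable \<Longrightarrow> norm X < \<delta> \<Longrightarrow> \<rho> < q \<Longrightarrow> q < 1
       \<Longrightarrow> \<exists>C. eventually (\<lambda>l. norm ((log_step \<theta> ^^ l) X) \<le> C * q ^ l) sequentially"
    using local_linear_convergence[of separable "log_step \<theta>" "linear_step \<theta>" \<rho>, OF subspace_separable
        log_step_separable step0 log_step_derivative \<rho>] by blast
  define U where "U = S \<inter> log_ratio -` ball 0 \<delta>"
  have S_neq_0: "x $ i $ j \<noteq> 0" if "x \<in> S" for x i j
    using diagonal_scalings_log_ratio(3)[OF g, of x i j] that by (simp add: S_def)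
  have "continuous_on S log_ratio"
    unfolding log_ratio_def by (intro continuous_intros) (auto dest: S_neq_0)
  then have "openin (top_of_set S) U"
    unfolding U_def by (intro continuous_openin_preimage_gen) auto
  moreover have "g \<in> U"
  proof -
    have "log_ratio g = 0" by (simp add: vec_eq_iff log_ratio_def)
    then show ?thesis using g \<delta>(1) by (simp add: U_def S_def)
  qed
  moreover have "(\<lambda>l. (overrelaxed_step \<mu>1 \<mu>2 \<theta> ^^ l) y) \<longlonglongrightarrow> g \<and>
      limsup (\<lambda>l. ereal (norm ((overrelaxed_step \<mu>1 \<mu>2 \<theta> ^^ l) y - g) powr (1 / real l))) \<le> ereal \<rho>"
    if y: "y \<in> U" for y
  proof -
    define X where "X l = (log_step \<theta> ^^ l) (log_ratio y)" for l
    define Y where "Y l = (overrelaxed_step \<mu>1 \<mu>2 \<theta> ^^ l) y" for l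
    have yS: "y \<in> diagonal_scalings c \<epsilon>" and small: "norm (log_ratio y) < \<delta>"
      using y by (auto simp: U_def S_def)
    have Y: "Y l = exp_scaling (X l)" for l
      using overrelaxed_iterate_exp_scaling[of l \<theta> "log_ratio y"] diagonal_scalings_log_ratio(2)[OF g yS]
      by (simp add: X_def Y_def)
    have X_geo: "\<exists>C. eventually (\<lambda>l. norm (X l) \<le> C * q ^ l) sequentially" if "\<rho> < q" "q < 1" for q
      using \<delta>(2)[OF diagonal_scalings_log_ratio(1)[OF g yS] small that] by (simp add: X_def)
    have geo_0: "(\<lambda>l. C * q ^ l) \<longlonglongrightarrow> 0" if "\<rho> < q" "q < 1" for C q :: real
      using that \<rho> by (intro tendsto_mult_right_zero LIMSEQ_power_zero) auto
    \<comment> \<open>A fixed admissible rate brings the orbit into the unit ball, where the bound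
      for \<open>exp_scaling\<close> applies, and later yields convergence.\<close>
    define q0 where "q0 = (\<rho> + 1) / 2"
    have q0: "\<rho> < q0" "q0 < 1" using \<rho> by (auto simp: q0_def)
    obtain C0 where "eventually (\<lambda>l. norm (X l) \<le> C0 * q0 ^ l) sequentially"
      using X_geo[OF q0] by blast
    moreover have "eventually (\<lambda>l. C0 * q0 ^ l < 1) sequentially"
      using geo_0[OF q0] by (rule order_tendstoD) simp
    ultimately have X1: "eventually (\<lambda>l. norm (X l) \<le> 1) sequentially"
      by eventually_elim simp
    obtain B where B: "0 \<le> B" "\<And>X. norm X \<le> 1 \<Longrightarrow> norm (exp_scaling X - g) \<le> B * norm X"
      using norm_exp_scaling_minus_le by metis
    have Y_geo: "\<exists>C. eventually (\<lambda>l. norm (Y l - g) \<le> C * q ^ l) sequentially" if q: "\<rho> < q" "q < 1" for q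
    proof -
      obtain C where "eventually (\<lambda>l. norm (X l) \<le> C * q ^ l) sequentially"
        using X_geo[OF q] by blast
      with X1 have "eventually (\<lambda>l. norm (Y l - g) \<le> (B * C) * q ^ l) sequentially"
      proof eventually_elim
        case (elim l)
        then have "norm (Y l - g) \<le> B * (C * q ^ l)"
          unfolding Y using B(1) by (intro order_trans[OF B(2)] mult_left_mono)
        then show ?case by (simp add: mult.assoc)
      qed
      then show ?thesis by blast
    qed
    obtain C where "eventually (\<lambda>l. norm (Y l - g) \<le> C * q0 ^ l) sequentially"
      using Y_geo[OF q0] by blast
    then have "(\<lambda>l. Y l - g) \<longlonglongrightarrow> 0"
      using geo_0[OF q0] by (rule Lim_null_comparison)
    then have "Y \<longlonglongrightarrow> g" by (simp add: LIM_zero_iff)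
    then show ?thesis
      using limsup_root_le_of_geometric_bounds[OF \<rho> Y_geo] by (simp add: Y_def[abs_def])
  qed
  ultimately show ?thesis
    unfolding converges_locally_at_rate_def \<rho>_def S_def by blast
qed

end

text \<open>Convergence for general \<open>\<theta>\<close> contains the other two convergence
  claims: \<open>rate\<close> equals \<open>1 - \<eta>\<close> at 1 and has a closed form at
  \<open>optimal_parameter \<eta>\<close>. The range of \<open>\<eta>\<close> comes from the
  spectrum of \<open>M1\<close>.\<close>

theorem proposition2:
  fixes \<mu>1 :: "real^'n1" and \<mu>2 :: "real^'n2"
    and c \<gamma>s :: "real^'n2^'n1"
    and \<epsilon> \<eta> :: real
  assumes "CARD('n1) \<ge> 2"
    and "discrete_probability \<mu>1" and "discrete_probability \<mu>2"
    and "\<forall>i j. 0 \<le> c $ i $ j"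
    and "\<epsilon> > 0"
    and "is_arg_min (entropic_cost c \<epsilon>) (\<lambda>\<gamma>. \<gamma> \<in> transport_plans \<mu>1 \<mu>2) \<gamma>s"
    and "1 - \<eta> = second_largest_eigenvalue (M1 \<mu>1 \<mu>2 \<gamma>s)"
  shows "converges_locally_at_rate (sinkhorn_knopp_step \<mu>1 \<mu>2)
           (diagonal_scalings c \<epsilon>) \<gamma>s (1 - \<eta>)
       \<and> is_arg_min (\<lambda>\<theta>. rate \<theta> \<eta>) (\<lambda>\<theta>. \<theta> \<in> {0<..<2}) (optimal_parameter \<eta>)
       \<and> converges_locally_at_rate (overrelaxed_step \<mu>1 \<mu>2 (optimal_parameter \<eta>))
             (diagonal_scalings c \<epsilon>) \<gamma>s ((1 - sqrt \<eta>) / (1 + sqrt \<eta>))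
       \<and> (\<forall>\<theta>\<in>{0<..<2}. converges_locally_at_rate (overrelaxed_step \<mu>1 \<mu>2 \<theta>)
             (diagonal_scalings c \<epsilon>) \<gamma>s (rate \<theta> \<eta>))"
proof -
  note min = assms(2,3,5,6)
  interpret positive_coupling \<mu>1 \<mu>2 \<gamma>s
    by unfold_locales (rule minimizer_positive[OF min] minimizer_marginals[OF min])+
  note \<eta> = spectral_gap_bounds[OF assms(1,7)]
  have conv: "converges_locally_at_rate (overrelaxed_step \<mu>1 \<mu>2 \<theta>) (diagonal_scalings c \<epsilon>) \<gamma>s (rate \<theta> \<eta>)"
    if "0 < \<theta>" "\<theta> < 2" for \<theta>
    using overrelaxed_converges_locally[OF assms(1,7) that minimizer_in_diagonal_scalings[OF min]] .
  have "converges_locally_at_rate (sinkhorn_knopp_step \<mu>1 \<mu>2) (diagonal_scalings c \<epsilon>) \<gamma>s (1 - \<eta>)"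
    using conv[of 1] rate_1[OF \<eta>] by (simp add: sinkhorn_knopp_step_def)
  moreover have opt: "0 < optimal_parameter \<eta>" "optimal_parameter \<eta> < 2"
    using optimal_parameter_bounds[OF \<eta>] by auto
  moreover have "is_arg_min (\<lambda>\<theta>. rate \<theta> \<eta>) (\<lambda>\<theta>. \<theta> \<in> {0<..<2}) (optimal_parameter \<eta>)"
  proof -
    have "\<not> rate \<theta> \<eta> < rate (optimal_parameter \<eta>) \<eta>" if "\<theta> \<in> {0<..<2}" for \<theta>
      using rate_optimal_le[OF \<eta>, of \<theta>] that by simp
    then show ?thesis using opt by (auto simp: is_arg_min_def)
  qed
  moreover have "converges_locally_at_rate (overrelaxed_step \<mu>1 \<mu>2 (optimal_parameter \<eta>))
      (diagonal_scalings c \<epsilon>) \<gamma>s ((1 - sqrt \<eta>) / (1 + sqrt \<eta>))"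
    using conv[OF opt] rate_optimal[OF \<eta>] by simp
  ultimately show ?thesis using conv by auto
qed

end
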